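(* Consider the generalized randomized subspace descent (GRSD) method $x^{k+1}=x^k-\alpha_kB_k\nabla f(x^k)$, $k\ge0$, where $f:\mathbb R^d\to\mathbb R$ is $C^1$, coercive, convex, definable, and has a locally Lipschitz continuous gradient. Suppose that the stepsizes satisfy $0<\alpha_k\le\bar\alpha<2$ for all $k$ and $\sum_{k=0}^\infty\alpha_k=+\infty$, that $f$ is upper $1$-smooth along every $B\in\mathscr B$, and that there are constants $M,\nu>0$ with $0\preceq B_k\preceq MI$ and $\mathbb E[B_k^2\mid\mathcal F_k]\succeq\nu I$ almost surely, for all $k\ge0$. Let $f^*:=\min f$, $S:=\{x:f(x)\le f(x^0)\}$, and let $\varphi$ be a global KL desingularization function of $f$. Fix $t_0>0$ and define $\phi(0):=0$ and, for $t>0$, $$\phi(t):=\frac1{(\varphi'(t))^2},\qquad\psi(t):=\int_t^{t_0}(\varphi'(s))^2\,ds .$$ Then $1/\sqrt\phi$ is integrable near zero, whereas $1/\phi$ is not integrable near zero. Consequently, with $c_1=(1-\frac{\bar\alpha}2)/M$, $c_2=\nu$, $c_3=M^2$, $\mathfrak h:=\frac{1-\log2}2$ and $A_k:=\sum_{i=0}^{k-1}\alpha_i$: (i) For all $k\ge1$, $$\mathbb E[f(x^k)-f^*]\le\exp\Big(-\mathfrak h\frac{c_2}{c_3\bar\alpha}A_k\Big)(f(x^0)-f^* )+\psi^{-1}\Big(\psi(f(x^0)-f^* )+\frac{c_1c_2}2A_k\Big),$$ and there exists a random variable $x^*$ such that $x^k\to x^*$ almost surely and in $L^1$, $x^*\in\arg\min_{x\in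 S}f(x)$ almost surely, and $$\mathbb E[\|x^k-x^*\|]\le\frac{\sqrt{c_3}}{c_1c_2}\,\varphi\big(\mathbb E[f(x^k)-f^*]\big)\qquad\forall k\ge0.$$ (ii) There exist almost surely finite random indices $K_2,K_3$ such that, almost surely, $$f(x^k)-f^*\le\psi^{-1}\Big(\frac{c_1c_2}2A_k\Big)\quad\forall k\ge K_2,\qquad \|x^k-x^*\|\le\frac{\sqrt2}{c_1\sqrt{c_2}}\,\varphi\Big(\psi^{-1}\Big(\frac{c_1c_2}2A_k\Big)\Big)\quad\forall k\ge K_3 .$$
   Context: Setting. $(\Omega,\mathcal F,\{\mathcal F_k\}_{k\ge0},\mathbb P)$ is a filtered probability space, $x^0\in\mathbb R^d$ is deterministic, $\{\alpha_k\}$ is deterministic, and $\{B_k\}_{k\ge0}$ are random symmetric positive semidefinite $d\times d$ matrices with $B_k$ $\mathcal F_{k+1}$-measurable; $\mathscr B$ is the collection of possible realizations of the $B_k$. $f$ is upper $1$-smooth along $B$ if $f(x+Bu)\le f(x)+\langle\nabla f(x),Bu\rangle+\frac12\langle u,Bu\rangle$ for all $x,u\in\mathbb R^d$. "Definable" means definable in a fixed o-minimal structure over the real field. Global KL desingularization function of $f$: a continuous concave function $\varphi:\mathbb R_+\to\mathbb R_+$ with $\varphi(0)=0$, continuously differentiable on $(0,+\infty)$ with $\varphi'>0$ there, such that $\varphi'(f(x)-f^* )\,\|\nabla f(x)\|\ge1$ for all $x\notin\arg\min f$. (It is a known theorem that one exists for every convex, definable, coercive $C^1$ function.) A nonnegative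 function is integrable near $0$ if it is integrable on $(0,\tau']$ for some $\tau'>0$. $\psi$ is strictly decreasing; $\psi(0):=+\infty$, $\psi^{-1}(+\infty)=0$, and $\psi^{-1}$ is the inverse of $\psi$, defined on $(\lim_{t\to\infty}\psi(t),+\infty]$. *)

theory Defs
  imports "HOL-Probability.Probability" "HOL-Library.Extended_Nat"
begin

section \<open>O-minimal structures over the real field\<close>

text \<open>
  \<open>\<real>\<^sup>n\<close> is modelled by the real lists of length \<open>n\<close>, and \<open>D n\<close> is the collection of definable
  subsets of \<open>\<real>\<^sup>n\<close>.  The axioms are van den Dries's: Boolean algebras closed under products with
  \<open>\<real>\<close> and under projection, containing the diagonals, the order and the graphs of the field
  operations; o-minimality is \<open>definable_1\<close>.  The predicate \<open>is_interval\<close> covers bounded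
  and unbounded intervals of all kinds as well as single points.
\<close>

locale o_minimal_structure =
  fixes D :: "nat \<Rightarrow> real list set set"
  assumes definable_subset: "A \<in> D n \<Longrightarrow> A \<subseteq> {xs. length xs = n}"
    and definable_empty: "{} \<in> D n"
    and definable_compl: "A \<in> D n \<Longrightarrow> {xs. length xs = n} - A \<in> D n"
    and definable_Un: "A \<in> D n \<Longrightarrow> A' \<in> D n \<Longrightarrow> A \<union> A' \<in> D n"
    and definable_Times_left: "A \<in> D n \<Longrightarrow> {y # xs |y xs. xs \<in> A} \<in> D (Suc n)"
    and definable_Times_right: "A \<in> D n \<Longrightarrow> {xs @ [y] |xs y. xs \<in> A} \<in> D (Suc n)"
    and definable_diagonal: "n > 0 \<Longrightarrow> {xs. length xs = n \<and> hd xs = last xs} \<in> D n"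
    and definable_projection: "A \<in> D (Suc n) \<Longrightarrow> butlast ` A \<in> D n"
    and definable_less: "{[x, y] |x y. x < y} \<in> D 2"
    and definable_add: "{[x, y, x + y] |x y. True} \<in> D 3"
    and definable_mult: "{[x, y, x * y] |x y. True} \<in> D 3"
    and definable_1:
      "D 1 = {(\<lambda>x. [x]) ` \<Union>\<J> |\<J>. finite \<J> \<and> (\<forall>J\<in>\<J>. is_interval J)}"

text \<open>
  A function is definable if its graph is.  The list \<open>cs\<close> fixes an order of the coordinates; since
  the structures are closed under permutations of coordinates, its choice is immaterial.
\<close>

definition definable_fun ::
    "(nat \<Rightarrow> real list set set) \<Rightarrow> (real^'d::finite \<Rightarrow> real) \<Rightarrow> bool" where
  "definable_fun D f \<longleftrightarrow>
     (\<exists>cs. distinct cs \<and> set cs = UNIV \<and>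
        {map (($) x) cs @ [f x] |x. True} \<in> D (Suc (length cs)))"


section \<open>Functions on \<open>\<real>\<^sup>d\<close>\<close>

definition grad :: "('v::real_inner \<Rightarrow> real) \<Rightarrow> 'v \<Rightarrow> 'v" where
  "grad f x = (THE D. GDERIV f x :> D)"

lemma grad_eq:
  assumes "GDERIV f x :> D"
  shows "grad f x = D"
  unfolding grad_def
proof (rule the_equality)
  fix D' assume "GDERIV f x :> D'"
  then have "(\<lambda>h. inner h D') = (\<lambda>h. inner h D)"
    using assms has_derivative_unique unfolding gderiv_def by blast
  then have "inner (D' - D) D' = inner (D' - D) D"
    by meson
  then have "inner (D' - D) (D' - D) = 0"
    by (simp add: inner_diff_right)
  then show "D' = D" by simp
qed (fact assms)

definition C1_fun :: "('v::real_inner \<Rightarrow> real) \<Rightarrow> bool" where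
  "C1_fun f \<longleftrightarrow> (\<forall>x. \<exists>D. GDERIV f x :> D) \<and> continuous_on UNIV (grad f)"

definition locally_lipschitz :: "('v::metric_space \<Rightarrow> 'w::metric_space) \<Rightarrow> bool" where
  "locally_lipschitz g \<longleftrightarrow> (\<forall>x. \<exists>r>0. \<exists>L. L-lipschitz_on (ball x r) g)"

definition coercive :: "('v::real_normed_vector \<Rightarrow> real) \<Rightarrow> bool" where
  "coercive f \<longleftrightarrow> filterlim f at_top at_infinity"

definition min_value :: "('v \<Rightarrow> real) \<Rightarrow> real" where
  "min_value f = (LEAST m. m \<in> range f)"

definition argmin_on :: "'v set \<Rightarrow> ('v \<Rightarrow> real) \<Rightarrow> 'v set" where
  "argmin_on S f = {x. is_arg_min f (\<lambda>y. y \<in> S) x}"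

definition KL_desingularization ::
    "('v::real_inner \<Rightarrow> real) \<Rightarrow> (real \<Rightarrow> real) \<Rightarrow> bool" where
  "KL_desingularization f \<phi> \<longleftrightarrow>
     continuous_on {0..} \<phi> \<and> concave_on {0..} \<phi> \<and> (\<forall>t\<ge>0. \<phi> t \<ge> 0) \<and> \<phi> 0 = 0 \<and>
     (\<forall>t>0. \<phi> differentiable (at t)) \<and> continuous_on {0<..} (deriv \<phi>) \<and>
     (\<forall>t>0. deriv \<phi> t > 0) \<and>
     (\<forall>x. x \<notin> argmin_on UNIV f \<longrightarrow> deriv \<phi> (f x - min_value f) * norm (grad f x) \<ge> 1)"

text \<open>For functions that are nonnegative on \<open>(0,\<infinity>)\<close>.\<close>

definition integrable_near_0 :: "(real \<Rightarrow> real) \<Rightarrow> bool" where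
  "integrable_near_0 g \<longleftrightarrow> (\<exists>\<tau>>0. set_integrable lborel {0<..\<tau>} g)"

text \<open>
  The integral is oriented, hence negative for \<open>t > t0\<close>.  On \<open>[0,\<infinity>)\<close> the function is injective
  in the intended use, so \<open>KL_psi_inv\<close> is then its inverse on the image
  \<open>(lim \<psi>, \<infinity>]\<close>, with value \<open>0\<close> at \<open>\<infinity>\<close>.
\<close>

definition KL_psi :: "(real \<Rightarrow> real) \<Rightarrow> real \<Rightarrow> real \<Rightarrow> ereal" where
  "KL_psi \<phi> t0 t = (if t = 0 then \<infinity> else ereal (LBINT s=ereal t..ereal t0. (deriv \<phi> s)\<^sup>2))"

definition KL_psi_inv :: "(real \<Rightarrow> real) \<Rightarrow> real \<Rightarrow> ereal \<Rightarrow> real" where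
  "KL_psi_inv \<phi> t0 = inv_into {0..} (KL_psi \<phi> t0)"


section \<open>Matrices\<close>

definition psd :: "real^'d^'d::finite \<Rightarrow> bool" where
  "psd A \<longleftrightarrow> transpose A = A \<and> (\<forall>u. 0 \<le> u \<bullet> (A *v u))"

definition loewner_le :: "real^'d^'d::finite \<Rightarrow> real^'d^'d \<Rightarrow> bool" where
  "loewner_le A B \<longleftrightarrow> psd (B - A)"

definition upper_1_smooth_along :: "(real^'d::finite \<Rightarrow> real) \<Rightarrow> real^'d^'d \<Rightarrow> bool" where
  "upper_1_smooth_along f B \<longleftrightarrow>
     (\<forall>x u. f (x + B *v u) \<le> f x + grad f x \<bullet> (B *v u) + 1/2 * (u \<bullet> (B *v u)))"


section \<open>Random matrices and the randomized subspace descent iteration\<close>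

definition realizations :: "'a measure \<Rightarrow> (nat \<Rightarrow> 'a \<Rightarrow> 'b) \<Rightarrow> 'b set" where
  "realizations P B = {B k \<omega> |k \<omega>. \<omega> \<in> space P}"

definition cond_exp_matrix ::
    "'a measure \<Rightarrow> 'a measure \<Rightarrow> ('a \<Rightarrow> real^'d^'d::finite) \<Rightarrow> 'a \<Rightarrow> real^'d^'d" where
  "cond_exp_matrix P G A \<omega> = (\<chi> i j. real_cond_exp P G (\<lambda>\<omega>'. A \<omega>' $ i $ j) \<omega>)"

primrec grsd ::
    "(real^'d::finite \<Rightarrow> real) \<Rightarrow> (nat \<Rightarrow> real) \<Rightarrow> (nat \<Rightarrow> 'a \<Rightarrow> real^'d^'d) \<Rightarrow> real^'d
      \<Rightarrow> nat \<Rightarrow> 'a \<Rightarrow> real^'d" where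
  "grsd f \<alpha> B x0 0 \<omega> = x0"
| "grsd f \<alpha> B x0 (Suc k) \<omega> =
     grsd f \<alpha> B x0 k \<omega> - \<alpha> k *\<^sub>R (B k \<omega> *v grad f (grsd f \<alpha> B x0 k \<omega>))"

definition converges_in_L1 ::
    "'a measure \<Rightarrow> (nat \<Rightarrow> 'a \<Rightarrow> 'v::{banach, second_countable_topology}) \<Rightarrow> ('a \<Rightarrow> 'v) \<Rightarrow> bool" where
  "converges_in_L1 P X Y \<longleftrightarrow>
     (\<forall>k. integrable P (X k)) \<and> integrable P Y \<and>
     (\<lambda>k. \<integral>\<omega>. norm (X k \<omega> - Y \<omega>) \<partial>P) \<longlonglongrightarrow> 0"

end

theory Submission
  imports Defs
begin

text \<open>
  Write \<open>r k = f (x k) - f_min\<close> and \<open>p = deriv \<phi>\<close>.  Along almost every path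
  \<open>r (k + 1) \<le> r k - c1 \<alpha> k (norm (B k (grad f (x k))))\<^sup>2\<close>, and with
  \<open>\<zeta> k = (norm (B k u))\<^sup>2\<close>, \<open>u\<close> the normalized gradient, the Kurdyka--Lojasiewicz inequality
  turns this into \<open>\<psi> (r k) \<ge> \<psi> (r 0) + c1 S k\<close> with \<open>S k = (\<Sum>i<k. \<alpha> i * \<zeta> i)\<close>.
  Since \<open>0 \<le> \<zeta> k \<le> M\<^sup>2\<close> and the conditional expectation of \<open>\<zeta> k\<close> is at least \<open>\<nu>\<close>, a Chernoff
  bound with base \<open>2\<close> controls the event \<open>S k \<le> \<nu> A k / 2\<close>; this is the exponential term of the
  rate in expectation.  With \<open>3/5\<close> in place of \<open>1/2\<close> and Borel--Cantelli it even gives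
  \<open>r k \<le> \<psi>_inv (c1 \<nu> / 2 * A (k + 1))\<close> eventually, almost surely.  The shift of the index leaves
  exactly the room needed to bound the remaining path length by AM-GM, Abel summation and the
  concavity of \<open>\<phi>\<close>; this gives almost sure convergence with the stated rate.  The bound in
  mean follows from \<open>\<phi> (r k) - \<phi> (r (k + 1)) \<ge> p (r k) (r k - r (k + 1))\<close>, telescoping and Jensen.
  Non-integrability of \<open>p\<^sup>2\<close> near \<open>0\<close> comes from the local Lipschitz continuity of the
  gradient, which forces \<open>(norm (grad f y))\<^sup>2 \<le> L (f y - f_min)\<close> near a minimizer.
\<close>

section \<open>Convex functions and their gradients\<close>

lemma C1_fun_gderiv:
  assumes "C1_fun f"
  shows "GDERIV f x :> grad f x"
proof -
  obtain D where D: "GDERIV f x :> D" using assms unfolding C1_fun_def by blast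
  with grad_eq[OF D] show ?thesis by simp
qed

lemma C1_fun_has_derivative:
  assumes "C1_fun f"
  shows "(f has_derivative (\<lambda>h. h \<bullet> grad f x)) (at x)"
  using C1_fun_gderiv[OF assms, of x] unfolding gderiv_def .

lemma C1_fun_continuous_on:
  assumes "C1_fun f"
  shows "continuous_on A f"
  using has_derivative_continuous[OF C1_fun_has_derivative[OF assms]]
  by (intro continuous_at_imp_continuous_on) blast

text \<open>Restriction to the line through \<open>x\<close> and \<open>y\<close> reduces the claim
  to the tangent inequality for convex functions of one real variable.\<close>

lemma convex_on_above_gradient:
  fixes f :: "'v::real_inner \<Rightarrow> real"
  assumes conv: "convex_on UNIV f" and C1: "C1_fun f"
  shows "f x + grad f x \<bullet> (y - x) \<le> f y"
proof -
  define h where "h s = f (x + s *\<^sub>R (y - x))" for s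
  have "convex_on UNIV h"
  proof (rule convex_onI)
    fix t a b :: real
    assume t: "0 < t" "t < 1"
    have "x + ((1 - t) *\<^sub>R a + t *\<^sub>R b) *\<^sub>R (y - x)
        = (1 - t) *\<^sub>R (x + a *\<^sub>R (y - x)) + t *\<^sub>R (x + b *\<^sub>R (y - x))"
      by (simp add: algebra_simps)
    then show "h ((1 - t) *\<^sub>R a + t *\<^sub>R b) \<le> (1 - t) * h a + t * h b"
      unfolding h_def using convex_onD[OF conv, of t "x + a *\<^sub>R (y - x)" "x + b *\<^sub>R (y - x)"] t by simp
  qed simp
  moreover have "(h has_real_derivative grad f x \<bullet> (y - x)) (at 0)"
  proof -
    have "((\<lambda>s. x + s *\<^sub>R (y - x)) has_derivative (\<lambda>s. s *\<^sub>R (y - x))) (at 0)"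
      by (auto intro!: derivative_eq_intros)
    from has_derivative_compose[OF this, of f "\<lambda>h. h \<bullet> grad f x"]
    have "(h has_derivative (\<lambda>s. (s *\<^sub>R (y - x)) \<bullet> grad f x)) (at 0)"
      unfolding h_def using C1_fun_has_derivative[OF C1, of x] by simp
    then show ?thesis
      unfolding has_field_derivative_def by (rule has_derivative_eq_rhs) (simp add: fun_eq_iff inner_commute)
  qed
  ultimately have "h 1 - h 0 \<ge> grad f x \<bullet> (y - x) * (1 - 0)"
    by (intro convex_on_imp_above_tangent[where A = UNIV]) auto
  then show ?thesis by (simp add: h_def)
qed

lemma grad_zero_at_minimum:
  assumes C1: "C1_fun f" and min: "\<And>y. f x \<le> f y"
  shows "grad f x = 0"
proof -
  have "(\<lambda>h. h \<bullet> grad f x) = (\<lambda>h. 0)"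
    using differential_zero_maxmin[OF _ open_UNIV C1_fun_has_derivative[OF C1]] min by blast
  then have "grad f x \<bullet> grad f x = 0" by metis
  then show ?thesis by simp
qed

lemma coercive_compact_sublevel:
  fixes f :: "'v::euclidean_space \<Rightarrow> real"
  assumes coer: "coercive f" and cont: "continuous_on UNIV f"
  shows "compact {x. f x \<le> c}"
proof -
  have "eventually (\<lambda>x. c < f x) at_infinity"
    using coer unfolding coercive_def filterlim_at_top_dense by blast
  then obtain b where b: "\<And>x. b \<le> norm x \<Longrightarrow> c < f x"
    unfolding eventually_at_infinity by blast
  have "bounded {x. f x \<le> c}"
    unfolding bounded_iff using b by (metis linorder_le_cases mem_Collect_eq not_less)
  moreover have "closed {x. f x \<le> c}"
    using cont by (intro closed_Collect_le continuous_intros)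
  ultimately show ?thesis by (simp add: compact_eq_bounded_closed)
qed

lemma coercive_attains_minimum:
  fixes f :: "'v::euclidean_space \<Rightarrow> real"
  assumes coer: "coercive f" and cont: "continuous_on UNIV f"
  shows "\<exists>z. \<forall>y. f z \<le> f y"
proof -
  have "compact {x. f x \<le> f 0}" using assms by (rule coercive_compact_sublevel)
  moreover have "{x. f x \<le> f 0} \<noteq> {}" by blast
  ultimately obtain z where "f z \<le> f 0" "\<And>y. f y \<le> f 0 \<Longrightarrow> f z \<le> f y"
    using continuous_attains_inf[of "{x. f x \<le> f 0}" f] continuous_on_subset[OF cont] by blast
  then have "f z \<le> f y" for y by (metis linorder_le_cases order_trans)
  then show ?thesis by blast
qed

lemma min_value_eq:
  assumes "\<And>y. f z \<le> f y"
  shows "min_value f = f z"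
  unfolding min_value_def using assms by (intro Least_equality) auto

lemma mem_argmin_on_iff: "x \<in> argmin_on A f \<longleftrightarrow> x \<in> A \<and> (\<forall>y\<in>A. f x \<le> f y)" for f :: "'v \<Rightarrow> real"
  by (auto simp: argmin_on_def is_arg_min_def not_less)

text \<open>The descent lemma with \<open>L\<close> in place of \<open>L/2\<close>: for convex functions it needs no integration.\<close>

lemma convex_descent:
  fixes f :: "'v::real_inner \<Rightarrow> real"
  assumes conv: "convex_on UNIV f" and C1: "C1_fun f"
    and lip: "norm (grad f (y + u) - grad f y) \<le> L * norm u"
  shows "f (y + u) \<le> f y + grad f y \<bullet> u + L * (norm u)\<^sup>2"
proof -
  have "f (y + u) + grad f (y + u) \<bullet> (- u) \<le> f y"
    using convex_on_above_gradient[OF conv C1, of "y + u" y] by simp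
  moreover have "(grad f (y + u) - grad f y) \<bullet> u \<le> L * norm u * norm u"
    by (meson lip mult_right_mono norm_cauchy_schwarz norm_ge_zero order_trans)
  ultimately show ?thesis by (simp add: inner_diff_left power2_eq_square)
qed

text \<open>Every small level above the minimum is attained near a frontier point of the set of
  minimizers, where the gradient is Lipschitz.\<close>

lemma small_gradient_on_levels:
  fixes f :: "'v::euclidean_space \<Rightarrow> real"
  assumes conv: "convex_on UNIV f" and C1: "C1_fun f" and coer: "coercive f"
    and lip: "locally_lipschitz (grad f)"
  obtains L \<tau> where "0 < L" "0 < \<tau>"
    "\<And>t. \<lbrakk>0 < t; t < \<tau>\<rbrakk> \<Longrightarrow> \<exists>y. f y - min_value f = t \<and> (norm (grad f y))\<^sup>2 \<le> L * t"
proof -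
  have cont: "continuous_on A f" for A using C1 by (rule C1_fun_continuous_on)
  obtain z where z: "\<And>y. f z \<le> f y" using coercive_attains_minimum[OF coer cont] by blast
  have fmin: "min_value f = f z" using z by (rule min_value_eq)
  define X where "X = {x. f x \<le> f z}"
  have "compact X" unfolding X_def using coer cont by (rule coercive_compact_sublevel)
  \<comment> \<open>Only the empty set and the whole space have empty frontier; \<open>X\<close>
    contains \<open>z\<close> and is bounded.\<close>
  then have "frontier X \<noteq> {}"
    using frontier_eq_empty[of X] not_bounded_UNIV compact_imp_bounded[of X] X_def by blast
  then obtain c where c: "c \<in> frontier X" by blast
  have "c \<in> X" using c \<open>compact X\<close> by (metis compact_imp_closed frontier_subset_closed subsetD)
  then have fc: "f c = f z" using z[of c] by (simp add: X_def)
  have gc: "grad f c = 0" using z fc by (intro grad_zero_at_minimum[OF C1]) simp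
  obtain r L0 where r: "0 < r" and L0: "L0-lipschitz_on (ball c r) (grad f)"
    using lip unfolding locally_lipschitz_def by blast
  define L where "L = max L0 1"
  have L: "1 \<le> L" and Llip: "L-lipschitz_on (ball c r) (grad f)"
    using lipschitz_on_le[OF L0, of L] by (auto simp: L_def)
  \<comment> \<open>Half the radius leaves room for the gradient step taken below from points of
    this ball.\<close>
  obtain y1 where y1: "y1 \<in> ball c (r/2)" "y1 \<notin> X"
    using c r unfolding frontier_straddle by (metis half_gt_zero mem_ball)
  have "\<exists>y. f y - min_value f = t \<and> (norm (grad f y))\<^sup>2 \<le> (4 * L) * t"
    if t: "0 < t" "t < f y1 - f z" for t
  proof -
    \<comment> \<open>The intermediate value theorem on the connected ball reaches every level
      between \<open>f z\<close> and \<open>f y1\<close>.\<close>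
    have "connected (f ` ball c (r/2))" using cont by (intro connected_continuous_image) auto
    moreover have "f z \<in> f ` ball c (r/2)" using fc r by (metis centre_in_ball half_gt_zero imageI)
    ultimately have "f z + t \<in> f ` ball c (r/2)"
      using connectedD_interval[of "f ` ball c (r/2)" "f z" "f y1" "f z + t"] y1(1) t by auto
    then obtain y where y: "y \<in> ball c (r/2)" "f y = f z + t" by auto
    define g where "g = grad f y"
    \<comment> \<open>This \<open>u\<close> minimizes the upper model
      \<open>g \<bullet> u + L * (norm u)\<^sup>2\<close>. The decrease it achieves,
      \<open>(norm g)\<^sup>2 / (4 * L)\<close>, cannot exceed the gap \<open>t\<close>.\<close>
    define u where "u = (- 1 / (2 * L)) *\<^sub>R g"
    have yr: "y \<in> ball c r" using y r by auto
    have "norm g \<le> L * norm (y - c)"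
      using lipschitz_onD[OF Llip yr, of c] r gc by (simp add: g_def dist_norm)
    then have nu: "norm u \<le> norm (y - c) / 2"
      using L by (simp add: u_def field_simps)
    have "dist c (y + u) \<le> norm (y - c) + norm u"
      using norm_triangle_ineq[of "y - c" u] by (simp add: dist_norm norm_minus_commute algebra_simps)
    also have "\<dots> < r"
      using nu y(1) r by (simp add: dist_norm norm_minus_commute)
    finally have "y + u \<in> ball c r" by simp
    then have "norm (grad f (y + u) - grad f y) \<le> L * norm u"
      using lipschitz_onD[OF Llip, of "y + u" y] yr by (simp add: dist_norm)
    from convex_descent[OF conv C1 this]
    have "f z \<le> f y + g \<bullet> u + L * (norm u)\<^sup>2" using z[of "y + u"] by (simp add: g_def)
    also have "g \<bullet> u = - (norm g)\<^sup>2 / (2 * L)" by (simp add: u_def power2_norm_eq_inner)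
    also have "L * (norm u)\<^sup>2 = (norm g)\<^sup>2 / (4 * L)"
      using L by (simp add: u_def power_mult_distrib power_divide) (simp add: power2_eq_square field_simps)
    finally have "(norm g)\<^sup>2 \<le> 4 * L * t" using L y(2) by (simp add: field_simps)
    then show ?thesis using y(2) fmin by (intro exI[of _ y]) (simp add: g_def)
  qed
  moreover have "0 < f y1 - f z" using y1(2) by (simp add: X_def)
  ultimately show thesis using L that[of "4 * L" "f y1 - f z"] by simp
qed


section \<open>Desingularization functions\<close>

text \<open>Everything about \<open>f\<close> that the one-dimensional calculus needs is condensed
  into \<open>deriv_blowup\<close>: near zero the squared derivative dominates a multiple of
  \<open>1 / t\<close>.\<close>

locale KL_function =
  fixes \<phi> :: "real \<Rightarrow> real" and t0 :: real
  assumes t0_pos: "0 < t0"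
    and cont: "continuous_on {0..} \<phi>"
    and concave: "concave_on {0..} \<phi>"
    and zero: "\<phi> 0 = 0"
    and differentiable: "0 < t \<Longrightarrow> \<phi> differentiable (at t)"
    and cont_deriv: "continuous_on {0<..} (deriv \<phi>)"
    and deriv_pos: "0 < t \<Longrightarrow> 0 < deriv \<phi> t"
    and deriv_blowup: "\<exists>L>0. \<exists>\<tau>>0. \<forall>t. 0 < t \<longrightarrow> t < \<tau> \<longrightarrow> 1 \<le> (deriv \<phi> t)\<^sup>2 * (L * t)"
begin

lemma has_deriv: "0 < t \<Longrightarrow> (\<phi> has_real_derivative deriv \<phi> t) (at t)"
  using differentiable by (simp add: DERIV_deriv_iff_real_differentiable)

text \<open>Concavity on the closed half line lets \<open>y\<close> be \<open>0\<close>, where no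
  derivative need exist; only the point of tangency must be positive.\<close>

lemma tangent_above:
  assumes "0 < m" "0 \<le> y"
  shows "\<phi> y \<le> \<phi> m + deriv \<phi> m * (y - m)"
proof -
  have "convex_on {0..} (\<lambda>x. - \<phi> x)" using concave unfolding concave_on_def .
  moreover have "((\<lambda>x. - \<phi> x) has_field_derivative - deriv \<phi> m) (at m within {0..})"
    using has_field_derivative_at_within[OF DERIV_minus[OF has_deriv[OF assms(1)]]] .
  ultimately have "- \<phi> y - - \<phi> m \<ge> - deriv \<phi> m * (y - m)"
    using assms by (intro convex_on_imp_above_tangent[where A = "{0..}"]) auto
  then show ?thesis by simp
qed

lemma increment_ge:
  assumes "0 \<le> a" "0 < b"
  shows "deriv \<phi> b * (b - a) \<le> \<phi> b - \<phi> a"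
  using tangent_above[OF assms(2,1)] by (simp add: algebra_simps)

lemma mono:
  assumes "0 \<le> a" "a \<le> b"
  shows "\<phi> a \<le> \<phi> b"
proof (cases "b = 0")
  case False
  with assms have "0 < b" by simp
  then have "0 \<le> deriv \<phi> b * (b - a)" using deriv_pos[of b] assms by simp
  with increment_ge[OF assms(1) \<open>0 < b\<close>] show ?thesis by linarith
qed (use assms in simp)

lemma nonneg: "0 \<le> a \<Longrightarrow> 0 \<le> \<phi> a"
  using mono[of 0 a] zero by simp

lemma deriv_antimono:
  assumes "0 < a" "a \<le> b"
  shows "deriv \<phi> b \<le> deriv \<phi> a"
proof (cases "a = b")
  case False
  have "deriv \<phi> b * (b - a) \<le> \<phi> b - \<phi> a" using assms by (intro increment_ge) auto
  moreover have "\<phi> b - \<phi> a \<le> deriv \<phi> a * (b - a)" using tangent_above[of a b] assms by simp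
  ultimately have "deriv \<phi> b * (b - a) \<le> deriv \<phi> a * (b - a)" by linarith
  then show ?thesis by (rule mult_right_le_imp_le) (use False assms(2) in simp)
qed simp

lemma tendsto_0: "(\<phi> \<longlongrightarrow> 0) (at 0 within {0..})"
  using cont zero unfolding continuous_on_def by (metis atLeast_iff order_refl)

lemma continuous_on_max: "continuous_on UNIV (\<lambda>t. \<phi> (max 0 t))"
  by (intro continuous_on_compose2[OF cont] continuous_intros) auto

lemma tendsto_comp_0:
  assumes "(u \<longlongrightarrow> 0) F"
  shows "((\<lambda>i. \<phi> (max 0 (u i))) \<longlongrightarrow> 0) F"
  using continuous_on_tendsto_compose[OF continuous_on_max assms] zero by simp

section \<open>The integral of the squared derivative\<close>

definition Psi :: "real \<Rightarrow> real" where
  "Psi t = (LBINT s=ereal t..ereal t0. (deriv \<phi> s)\<^sup>2)"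

text \<open>The continuous integrand has an antiderivative \<open>Q\<close> on all of the positive
  half line, and there \<open>Psi\<close> equals \<open>Q t0 - Q\<close>, for either orientation of
  the integral.\<close>

lemma Psi_has_deriv:
  assumes "0 < t"
  shows "(Psi has_real_derivative - (deriv \<phi> t)\<^sup>2) (at t)"
proof -
  have c2: "continuous_on {0<..} (\<lambda>s. (deriv \<phi> s)\<^sup>2)" by (intro continuous_intros cont_deriv)
  have "isCont (\<lambda>s. (deriv \<phi> s)\<^sup>2) s" if "0 < s" for s
    using continuous_on_interior[OF c2, of s] that by (simp add: interior_open)
  then obtain Q where Q: "\<And>s. 0 < s \<Longrightarrow> (Q has_vector_derivative (deriv \<phi> s)\<^sup>2) (at s)"
    using einterval_antiderivative[of 0 \<infinity> "\<lambda>s. (deriv \<phi> s)\<^sup>2"] by (auto simp: zero_ereal_def)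
  have eq: "Q t0 - Q s = Psi s" if "0 < s" for s
    unfolding Psi_def
  proof (rule interval_integral_FTC_finite[symmetric])
    show "continuous_on {min s t0..max s t0} (\<lambda>s. (deriv \<phi> s)\<^sup>2)"
      using c2 by (rule continuous_on_subset) (use that t0_pos in auto)
    show "(Q has_vector_derivative (deriv \<phi> x)\<^sup>2) (at x within {min s t0..max s t0})"
      if "min s t0 \<le> x" for x
      by (rule has_vector_derivative_at_within, rule Q) (use that \<open>0 < s\<close> t0_pos in linarith)
  qed
  have "((\<lambda>s. Q t0 - Q s) has_real_derivative - (deriv \<phi> t)\<^sup>2) (at t)"
    using Q[OF assms] by (auto intro!: derivative_eq_intros simp: has_real_derivative_iff_has_vector_derivative)
  then show ?thesis
    by (rule has_field_derivative_transform_within_open[of _ _ _ "{0<..}"]) (use assms eq in auto)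
qed

lemma Psi_t0: "Psi t0 = 0"
  by (simp add: Psi_def)

text \<open>On \<open>[a, b]\<close> the integrand is smallest at \<open>b\<close>, because
  \<open>deriv \<phi>\<close> decreases.\<close>

lemma Psi_diff_ge:
  assumes "0 < a" "a \<le> b"
  shows "(deriv \<phi> b)\<^sup>2 * (b - a) \<le> Psi a - Psi b"
proof -
  have "Psi b + (deriv \<phi> b)\<^sup>2 * b \<le> Psi a + (deriv \<phi> b)\<^sup>2 * a"
  proof (rule DERIV_nonpos_imp_nonincreasing[OF assms(2)])
    fix s assume s: "a \<le> s" "s \<le> b"
    have "((\<lambda>s. Psi s + (deriv \<phi> b)\<^sup>2 * s) has_real_derivative - (deriv \<phi> s)\<^sup>2 + (deriv \<phi> b)\<^sup>2) (at s)"
      using s assms by (auto intro!: derivative_eq_intros Psi_has_deriv)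
    moreover have "(deriv \<phi> b)\<^sup>2 \<le> (deriv \<phi> s)\<^sup>2"
      using s assms deriv_pos[of b] deriv_antimono[of s b] by (intro power_mono) auto
    ultimately show "\<exists>y. ((\<lambda>s. Psi s + (deriv \<phi> b)\<^sup>2 * s) has_real_derivative y) (at s) \<and> y \<le> 0"
      by force
  qed
  then show ?thesis by (simp add: algebra_simps)
qed

text \<open>One factor of the squared derivative is replaced by its largest value, at
  \<open>a\<close>; the other integrates to the increment of \<open>\<phi>\<close>.\<close>

lemma Psi_diff_le:
  assumes "0 < a" "a \<le> b"
  shows "Psi a - Psi b \<le> deriv \<phi> a * (\<phi> b - \<phi> a)"
proof -
  have "Psi a + deriv \<phi> a * \<phi> a \<le> Psi b + deriv \<phi> a * \<phi> b"
  proof (rule DERIV_nonneg_imp_nondecreasing[OF assms(2)])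
    fix s assume s: "a \<le> s" "s \<le> b"
    have "((\<lambda>s. Psi s + deriv \<phi> a * \<phi> s) has_real_derivative
        - (deriv \<phi> s)\<^sup>2 + deriv \<phi> a * deriv \<phi> s) (at s)"
      using s assms by (auto intro!: derivative_eq_intros Psi_has_deriv has_deriv)
    moreover have "deriv \<phi> s * deriv \<phi> s \<le> deriv \<phi> a * deriv \<phi> s"
      using s assms deriv_pos[of s] deriv_antimono[of a s] by (intro mult_right_mono) auto
    ultimately show "\<exists>y. ((\<lambda>s. Psi s + deriv \<phi> a * \<phi> s) has_real_derivative y) (at s) \<and> 0 \<le> y"
      by (force simp: power2_eq_square)
  qed
  then show ?thesis by (simp add: algebra_simps)
qed

lemma Psi_strict_antimono:
  assumes "0 < a" "a < b"
  shows "Psi b < Psi a"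
proof -
  have "0 < (deriv \<phi> b)\<^sup>2 * (b - a)" using deriv_pos[of b] assms by simp
  with Psi_diff_ge[of a b] assms show ?thesis by simp
qed

lemma Psi_le_iff: "0 < a \<Longrightarrow> 0 < b \<Longrightarrow> Psi a \<le> Psi b \<longleftrightarrow> b \<le> a"
  by (metis Psi_strict_antimono linorder_not_le order_le_less)

text \<open>By \<open>deriv_blowup\<close> the integrand dominates \<open>1 / (L * s)\<close> near
  zero, so \<open>Psi\<close> grows at least like \<open>- ln s / L\<close>.\<close>

lemma Psi_unbounded: "\<exists>s. 0 < s \<and> s \<le> b \<and> v \<le> Psi s" if "0 < b" for b v
proof -
  obtain L \<tau> where L: "0 < L" and \<tau>: "0 < \<tau>"
    and blow: "\<And>t. 0 < t \<Longrightarrow> t < \<tau> \<Longrightarrow> 1 \<le> (deriv \<phi> t)\<^sup>2 * (L * t)"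
    using deriv_blowup by blast
  define m where "m = min b (\<tau> / 2)"
  have m: "0 < m" "m < \<tau>" "m \<le> b" using that \<tau> by (auto simp: m_def)
  have low: "Psi m - ln s / L + ln m / L \<le> Psi s" if s: "0 < s" "s \<le> m" for s
  proof -
    have "Psi m + ln m / L \<le> Psi s + ln s / L"
    proof (rule DERIV_nonpos_imp_nonincreasing[OF s(2)])
      fix u assume u: "s \<le> u" "u \<le> m"
      have "((\<lambda>s. Psi s + ln s / L) has_real_derivative - (deriv \<phi> u)\<^sup>2 + (1 / u) / L) (at u)"
        using s u L by (auto intro!: derivative_eq_intros Psi_has_deriv)
      moreover have "(1 / u) / L \<le> (deriv \<phi> u)\<^sup>2"
        using blow[of u] s u m L by (simp add: field_simps)
      ultimately show "\<exists>y. ((\<lambda>s. Psi s + ln s / L) has_real_derivative y) (at u) \<and> y \<le> 0"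
        by force
    qed
    then show ?thesis by simp
  qed
  \<comment> \<open>The exponential solves \<open>Psi m - ln s / L + ln m / L = v\<close>; the
    minimum keeps \<open>s\<close> where the logarithmic bound holds.\<close>
  define s where "s = min m (exp (L * (Psi m + ln m / L - v)))"
  have s: "0 < s" "s \<le> m" using m by (auto simp: s_def)
  have "ln s \<le> ln (exp (L * (Psi m + ln m / L - v)))"
    using s(1) by (subst ln_le_cancel_iff) (auto simp: s_def)
  then have "ln s \<le> L * (Psi m + ln m / L - v)" by simp
  then have "ln s / L \<le> Psi m + ln m / L - v"
    using L by (simp add: pos_divide_le_eq mult.commute)
  then have "v \<le> Psi m - ln s / L + ln m / L" by linarith
  then show ?thesis using low[OF s] s m by (intro exI[of _ s]) linarith
qed

lemma Psi_attains:
  assumes "0 < b" "Psi b \<le> v"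
  shows "\<exists>s. 0 < s \<and> s \<le> b \<and> Psi s = v"
proof -
  obtain a where a: "0 < a" "a \<le> b" "v \<le> Psi a" using Psi_unbounded[OF assms(1)] by blast
  have "continuous_on {a..b} Psi"
    using a by (intro DERIV_continuous_on[of _ _ "\<lambda>t. - (deriv \<phi> t)\<^sup>2"])
      (auto intro: has_field_derivative_at_within[OF Psi_has_deriv])
  with IVT2'[of Psi b v a] assms a obtain s where "a \<le> s" "s \<le> b" "Psi s = v" by blast
  with a show ?thesis by (intro exI[of _ s]) simp
qed

section \<open>The inverse of psi\<close>

lemma KL_psi_eq: "KL_psi \<phi> t0 t = (if t = 0 then \<infinity> else ereal (Psi t))"
  by (simp add: KL_psi_def Psi_def)

lemma inj_KL_psi: "inj_on (KL_psi \<phi> t0) {0..}"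
proof (rule inj_onI)
  fix a b :: real
  assume "a \<in> {0..}" "b \<in> {0..}" and eq: "KL_psi \<phi> t0 a = KL_psi \<phi> t0 b"
  then show "a = b"
    using Psi_le_iff[of a b] Psi_le_iff[of b a] by (auto simp: KL_psi_eq split: if_splits)
qed

lemma KL_psi_inv_psi: "0 \<le> t \<Longrightarrow> KL_psi_inv \<phi> t0 (KL_psi \<phi> t0 t) = t"
  unfolding KL_psi_inv_def by (rule inv_into_f_f[OF inj_KL_psi]) simp

lemma KL_psi_inv_infinity: "KL_psi_inv \<phi> t0 \<infinity> = 0"
  using KL_psi_inv_psi[of 0] by (simp add: KL_psi_eq)

lemma KL_psi_inv_Psi: "0 < t \<Longrightarrow> KL_psi_inv \<phi> t0 (ereal (Psi t)) = t"
  using KL_psi_inv_psi[of t] by (simp add: KL_psi_eq)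

lemma KL_psi_inv_pos_Psi:
  assumes "0 < b" "Psi b \<le> v"
  shows "0 < KL_psi_inv \<phi> t0 (ereal v)" "Psi (KL_psi_inv \<phi> t0 (ereal v)) = v"
  using Psi_attains[OF assms] KL_psi_inv_Psi by auto

text \<open>The comparison point \<open>b\<close> certifies that \<open>v\<close> lies in the range
  of \<open>Psi\<close>. For \<open>r \<le> 0\<close> the claim only needs the inverse to be
  positive, so the lower bound on \<open>Psi r\<close> is asked for positive \<open>r\<close>
  alone.\<close>

lemma le_KL_psi_inv:
  assumes "0 < b" "Psi b \<le> v" and "0 < r \<Longrightarrow> v \<le> Psi r"
  shows "r \<le> KL_psi_inv \<phi> t0 (ereal v)"
  using KL_psi_inv_pos_Psi[OF assms(1,2)] assms(3) Psi_le_iff[of "KL_psi_inv \<phi> t0 (ereal v)" r]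
  by (cases "0 < r") auto

lemma KL_psi_inv_tendsto_0:
  assumes "filterlim v at_top F"
  shows "((\<lambda>k. KL_psi_inv \<phi> t0 (ereal (v k))) \<longlongrightarrow> 0) F"
proof (rule tendsto_sandwich[of "\<lambda>_. 0"])
  have ge: "eventually (\<lambda>k. c \<le> v k) F" for c
    using assms unfolding filterlim_at_top by blast
  show "eventually (\<lambda>k. 0 \<le> KL_psi_inv \<phi> t0 (ereal (v k))) F"
    using ge[of "Psi t0"] by eventually_elim (use KL_psi_inv_pos_Psi(1)[OF t0_pos] in force)
  show "((\<lambda>k. KL_psi_inv \<phi> t0 (ereal (v k))) \<longlongrightarrow> 0) F"
  proof (rule tendstoI)
    fix e :: real assume "0 < e"
    show "eventually (\<lambda>k. dist (KL_psi_inv \<phi> t0 (ereal (v k))) 0 < e) F"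
      using ge[of "Psi (e / 2)"]
    proof eventually_elim
      case (elim k)
      have "0 < e / 2" using \<open>0 < e\<close> by simp
      note inv = KL_psi_inv_pos_Psi[OF this elim]
      then have "KL_psi_inv \<phi> t0 (ereal (v k)) \<le> e / 2"
        using Psi_le_iff[of "e / 2" "KL_psi_inv \<phi> t0 (ereal (v k))"] elim \<open>0 < e\<close> by simp
      then show ?case using inv(1) \<open>0 < e\<close> by simp
    qed
  qed
qed auto

section \<open>Integrability near zero\<close>

lemma integrable_near_0_deriv: "integrable_near_0 (deriv \<phi>)"
  unfolding integrable_near_0_def
proof (intro exI conjI)
  \<comment> \<open>The integrand is nonnegative and its antiderivative \<open>\<phi>\<close> has
    finite limits at both ends; at zero this is continuity of \<open>\<phi>\<close>.\<close>
  have "set_integrable lborel (einterval 0 1) (deriv \<phi>)"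
  proof (rule interval_integral_FTC_nonneg[where F = \<phi>])
    fix s :: real assume s: "0 < ereal s" "ereal s < 1"
    then show "(\<phi> has_real_derivative deriv \<phi> s) (at s)" by (intro has_deriv) simp
    show "isCont (deriv \<phi>) s"
      using continuous_on_interior[OF cont_deriv, of s] s by (simp add: interior_open)
  next
    show "((\<phi> \<circ> real_of_ereal) \<longlongrightarrow> 0) (at_right 0)"
      unfolding zero_ereal_def ereal_tendsto_simps
      by (rule tendsto_within_subset[OF tendsto_0]) auto
    have "(\<phi> \<longlongrightarrow> \<phi> 1) (at_left 1)"
      using DERIV_isCont[OF has_deriv[of 1]] by (simp add: isCont_def filterlim_at_split)
    then show "((\<phi> \<circ> real_of_ereal) \<longlongrightarrow> \<phi> 1) (at_left 1)"
      unfolding one_ereal_def ereal_tendsto_simps .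
  qed (auto simp: deriv_pos less_imp_le)
  then show "set_integrable lborel {0<..1/2} (deriv \<phi>)"
    by (rule set_integrable_subset) (auto simp: einterval_def zero_ereal_def one_ereal_def)
qed simp

lemma not_integrable_near_0_deriv_square: "\<not> integrable_near_0 (\<lambda>t. (deriv \<phi> t)\<^sup>2)"
proof
  assume "integrable_near_0 (\<lambda>t. (deriv \<phi> t)\<^sup>2)"
  then obtain \<tau> where \<tau>: "0 < \<tau>" and int: "set_integrable lborel {0<..\<tau>} (\<lambda>t. (deriv \<phi> t)\<^sup>2)"
    unfolding integrable_near_0_def by blast
  define I where "I = (LBINT t:{0<..\<tau>}. (deriv \<phi> t)\<^sup>2)"
  define b where "b = min \<tau> t0"
  have b: "0 < b" "b \<le> \<tau>" "b \<le> t0" using \<tau> t0_pos by (auto simp: b_def)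
  \<comment> \<open>The mass on \<open>[s, b]\<close> is \<open>Psi s - Psi b\<close>, which this
    \<open>s\<close> pushes above the supposedly finite total \<open>I\<close>.\<close>
  obtain s where s: "0 < s" "s \<le> b" "Psi b + I + 1 \<le> Psi s" using Psi_unbounded[OF b(1)] by blast
  have sub: "{s..b} \<subseteq> {0<..\<tau>}" using s(1) b(2) by force
  have "Psi s - Psi b = (LBINT t=s..b. (deriv \<phi> t)\<^sup>2)"
  proof -
    have "(LBINT t=s..b. (deriv \<phi> t)\<^sup>2) = (- Psi b) - (- Psi s)"
    proof (rule interval_integral_FTC_finite)
      show "continuous_on {min s b..max s b} (\<lambda>t. (deriv \<phi> t)\<^sup>2)"
        by (intro continuous_intros continuous_on_subset[OF cont_deriv]) (use s in auto)
      fix u assume "min s b \<le> u"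
      then show "((\<lambda>u. - Psi u) has_vector_derivative (deriv \<phi> u)\<^sup>2) (at u within {min s b..max s b})"
        unfolding has_real_derivative_iff_has_vector_derivative[symmetric]
        using s has_field_derivative_at_within[OF DERIV_minus[OF Psi_has_deriv[of u]]] by auto
    qed
    then show ?thesis by simp
  qed
  also have "\<dots> = (LBINT t:{s..b}. (deriv \<phi> t)\<^sup>2)" using s by (simp add: interval_integral_Icc)
  also have "\<dots> \<le> I"
    unfolding I_def set_lebesgue_integral_def
  proof (rule integral_mono)
    show "integrable lborel (\<lambda>t. indicator {s..b} t *\<^sub>R (deriv \<phi> t)\<^sup>2)"
      using set_integrable_subset[OF int, of "{s..b}"] sub unfolding set_integrable_def by simp
    show "integrable lborel (\<lambda>t. indicator {0<..\<tau>} t *\<^sub>R (deriv \<phi> t)\<^sup>2)"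
      using int unfolding set_integrable_def .
    show "indicator {s..b} t *\<^sub>R (deriv \<phi> t)\<^sup>2 \<le> indicator {0<..\<tau>} t *\<^sub>R (deriv \<phi> t)\<^sup>2" for t
      using sub by (auto simp: indicator_def)
  qed
  finally show False using s(3) by linarith
qed

text \<open>Cauchy--Schwarz would bound the sum by the geometric mean of the two telescoping sums below;
  weighting each term by AM-GM with the optimal constant \<open>\<epsilon>\<close> has the same effect.  The shift
  in \<open>r i \<le> t (Suc i)\<close> is what makes both sums telescope without loss.\<close>

lemma path_length_bound:
  assumes c: "0 < c1" "0 < c2"
    and \<alpha>: "\<And>i. 0 < \<alpha> i" and t: "\<And>i. 0 < t i"
    and Psi_t: "\<And>i. Psi (t (Suc i)) - Psi (t i) = c1 * c2 / 2 * \<alpha> i"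
    and r: "\<And>i. k \<le> i \<Longrightarrow> 0 \<le> r i" "\<And>i. k \<le> i \<Longrightarrow> r i \<le> t (Suc i)"
    and descent: "\<And>i. k \<le> i \<Longrightarrow> c1 * \<alpha> i * (v i)\<^sup>2 \<le> r i - r (Suc i)"
  shows "(\<Sum>i = k..<n. \<alpha> i * v i) \<le> sqrt 2 / (c1 * sqrt c2) * \<phi> (t k)"
proof (cases "k \<le> n")
  case True
  define w where "w i = deriv \<phi> (t (Suc i))" for i
  have w: "0 < w i" for i using deriv_pos t by (simp add: w_def)
  have "Psi (t i) \<le> Psi (t (Suc i))" for i
  proof -
    have "0 \<le> c1 * c2 / 2 * \<alpha> i" using c \<alpha>[of i] by simp
    with Psi_t[of i] show ?thesis by linarith
  qed
  then have t_dec: "t (Suc i) \<le> t i" for i using Psi_le_iff t by blast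
  have w_inc: "w i \<le> w (Suc i)" for i
    unfolding w_def using t t_dec by (intro deriv_antimono)
  \<comment> \<open>Abel summation as an induction: both sides vanish at \<open>n = k\<close>. Since
    the slack \<open>t (Suc i) - r i\<close> is nonnegative, the growth of the weights
    \<open>w\<close> only helps, and concavity pays for the decrease of \<open>t\<close>.\<close>
  have "(\<Sum>i = k..<n. (r i - r (Suc i)) * w i)
      \<le> \<phi> (t (Suc k)) - \<phi> (t (Suc n)) + (t (Suc n) - r n) * w n - (t (Suc k) - r k) * w k"
    using True
  proof (induction n rule: dec_induct)
    case (step m)
    have "w m * (t (Suc m) - t (Suc (Suc m))) \<le> \<phi> (t (Suc m)) - \<phi> (t (Suc (Suc m)))"
      unfolding w_def using t less_imp_le by (intro increment_ge) blast+
    moreover have "(t (Suc (Suc m)) - r (Suc m)) * w m \<le> (t (Suc (Suc m)) - r (Suc m)) * w (Suc m)"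
      using r(2)[of "Suc m"] step.hyps w_inc by (intro mult_left_mono) auto
    ultimately show ?case using step by (simp add: algebra_simps)
  qed simp
  also have "\<dots> \<le> \<phi> (t k)"
  proof -
    \<comment> \<open>Concavity down to zero absorbs the boundary term
      \<open>t (Suc n) * w n\<close> at the end of the path.\<close>
    have "w n * (t (Suc n) - 0) \<le> \<phi> (t (Suc n)) - \<phi> 0"
      unfolding w_def by (intro increment_ge t) simp
    moreover have "0 \<le> (t (Suc k) - r k) * w k" using r(2)[of k] w[of k] by simp
    moreover have "0 \<le> r n * w n" using r(1)[OF True] w[of n] by simp
    moreover have "\<phi> (t (Suc k)) \<le> \<phi> (t k)" using t t_dec less_imp_le by (intro mono) blast+
    ultimately show ?thesis by (simp add: zero algebra_simps)
  qed
  finally have sum1: "(\<Sum>i = k..<n. (r i - r (Suc i)) * w i) \<le> \<phi> (t k)" .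
  have "(\<Sum>i = k..<n. c1 * c2 / 2 * \<alpha> i / w i) \<le> (\<Sum>i = k..<n. \<phi> (t i) - \<phi> (t (Suc i)))"
  proof (rule sum_mono)
    fix i
    have "c1 * c2 / 2 * \<alpha> i \<le> w i * (\<phi> (t i) - \<phi> (t (Suc i)))"
      using Psi_diff_le[OF t t_dec, of i] Psi_t[of i] by (simp add: w_def)
    then show "c1 * c2 / 2 * \<alpha> i / w i \<le> \<phi> (t i) - \<phi> (t (Suc i))"
      using w[of i] by (simp add: field_simps)
  qed
  also have "\<dots> = \<phi> (t k) - \<phi> (t n)"
    using sum_Suc_diff'[OF True, of "\<lambda>i. - \<phi> (t i)"] by simp
  also have "\<dots> \<le> \<phi> (t k)" using nonneg[of "t n"] t[of n] by simp
  finally have sum2: "(\<Sum>i = k..<n. c1 * c2 / 2 * \<alpha> i / w i) \<le> \<phi> (t k)" .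
  \<comment> \<open>With \<open>\<epsilon>\<^sup>2 * c2 = 2\<close> the two AM-GM terms carry the
    same weight relative to \<open>sum1\<close> and \<open>sum2\<close>, both bounded by
    \<open>\<phi> (t k)\<close>.\<close>
  define \<epsilon> where "\<epsilon> = sqrt 2 / sqrt c2"
  have \<epsilon>: "0 < \<epsilon>" "\<epsilon>\<^sup>2 * c2 = 2" using c by (auto simp: \<epsilon>_def power_divide)
  have "\<alpha> i * v i \<le> \<epsilon> / (2 * c1) * ((r i - r (Suc i)) * w i + c1 * c2 / 2 * \<alpha> i / w i)"
    if i: "k \<le> i" for i
  proof -
    have "0 \<le> \<alpha> i / (\<epsilon> * w i) * (\<epsilon> * w i * v i - 1)\<^sup>2"
      using \<alpha>[of i] w[of i] \<epsilon> by simp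
    also have "\<dots> = \<epsilon> * (\<alpha> i * (v i)\<^sup>2 * w i) + \<alpha> i / (\<epsilon> * w i) - 2 * (\<alpha> i * v i)"
      using w[of i] \<epsilon>(1) by (simp add: power2_eq_square field_simps)
    also have "\<alpha> i / (\<epsilon> * w i) = \<epsilon> * (c2 / 2 * \<alpha> i / w i)"
      using \<epsilon> w[of i] by (simp add: power2_eq_square field_simps)
    finally have "2 * (\<alpha> i * v i) \<le> \<epsilon> * (\<alpha> i * (v i)\<^sup>2 * w i + c2 / 2 * \<alpha> i / w i)"
      by (simp add: algebra_simps)
    also have "\<alpha> i * (v i)\<^sup>2 * w i + c2 / 2 * \<alpha> i / w i
        = (c1 * \<alpha> i * (v i)\<^sup>2 * w i + c1 * c2 / 2 * \<alpha> i / w i) / c1"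
      using c by (simp add: field_simps)
    also have "\<epsilon> * \<dots> \<le> \<epsilon> * (((r i - r (Suc i)) * w i + c1 * c2 / 2 * \<alpha> i / w i) / c1)"
      using descent[OF i] w[of i] c \<epsilon>(1)
      by (intro mult_left_mono divide_right_mono add_right_mono mult_right_mono) auto
    finally show ?thesis using c by (simp add: field_simps)
  qed
  then have "(\<Sum>i = k..<n. \<alpha> i * v i)
      \<le> (\<Sum>i = k..<n. \<epsilon> / (2 * c1) * ((r i - r (Suc i)) * w i + c1 * c2 / 2 * \<alpha> i / w i))"
    by (intro sum_mono) simp
  also have "\<dots> = \<epsilon> / (2 * c1)
      * ((\<Sum>i = k..<n. (r i - r (Suc i)) * w i) + (\<Sum>i = k..<n. c1 * c2 / 2 * \<alpha> i / w i))"
    by (simp only: sum.distrib sum_distrib_left[symmetric])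
  also have "\<dots> \<le> \<epsilon> / (2 * c1) * (\<phi> (t k) + \<phi> (t k))"
    using sum1 sum2 \<epsilon>(1) c by (intro mult_left_mono add_mono) auto
  also have "\<dots> = sqrt 2 / (c1 * sqrt c2) * \<phi> (t k)"
    using c by (simp add: \<epsilon>_def field_simps)
  finally show ?thesis .
next
  case False
  then show ?thesis using nonneg[of "t k"] t[of k] c by (simp add: less_imp_le)
qed

end

lemma integrable_near_0_cong:
  assumes "\<And>t. 0 < t \<Longrightarrow> g t = h t"
  shows "integrable_near_0 g \<longleftrightarrow> integrable_near_0 h"
  unfolding integrable_near_0_def using assms
  by (intro ex_cong1 conj_cong refl set_integrable_cong) auto

lemma KL_desingularization_gradient:
  assumes "KL_desingularization f \<phi>" "min_value f < f y"
    and "\<And>y. min_value f \<le> f y" "min_value f \<in> range f"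
  shows "1 \<le> deriv \<phi> (f y - min_value f) * norm (grad f y)"
proof -
  obtain z where "min_value f = f z" using assms(4) by blast
  then have "y \<notin> argmin_on UNIV f" using assms(2) by (auto simp: mem_argmin_on_iff not_le)
  then show ?thesis using assms(1) by (simp add: KL_desingularization_def)
qed

text \<open>Each small level \<open>t\<close> contains a point with
  \<open>(norm (grad f y))\<^sup>2 \<le> L * t\<close>; squaring the Kurdyka--Lojasiewicz inequality
  there gives the blow-up of the derivative.\<close>

lemma KL_function_if_KL_desingularization:
  fixes f :: "'v::euclidean_space \<Rightarrow> real"
  assumes KL: "KL_desingularization f \<phi>"
    and conv: "convex_on UNIV f" and C1: "C1_fun f" and coer: "coercive f"
    and lip: "locally_lipschitz (grad f)" and t0: "0 < t0"
    and min: "\<And>y. min_value f \<le> f y" "min_value f \<in> range f"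
  shows "KL_function \<phi> t0"
proof
  obtain L \<tau> where L: "0 < L" "0 < \<tau>"
    and level: "\<And>t. 0 < t \<Longrightarrow> t < \<tau> \<Longrightarrow> \<exists>y. f y - min_value f = t \<and> (norm (grad f y))\<^sup>2 \<le> L * t"
    using small_gradient_on_levels[OF conv C1 coer lip] by blast
  have "1 \<le> (deriv \<phi> t)\<^sup>2 * (L * t)" if t: "0 < t" "t < \<tau>" for t
  proof -
    obtain y where y: "f y - min_value f = t" "(norm (grad f y))\<^sup>2 \<le> L * t" using level[OF t] by blast
    have "1 \<le> deriv \<phi> t * norm (grad f y)"
      using KL_desingularization_gradient[OF KL _ min, of y] y(1) t(1) by simp
    then have "1 \<le> (deriv \<phi> t * norm (grad f y))\<^sup>2" by simp
    also have "\<dots> \<le> (deriv \<phi> t)\<^sup>2 * (L * t)"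
      unfolding power_mult_distrib using y(2) by (intro mult_left_mono) auto
    finally show ?thesis .
  qed
  with L show "\<exists>L>0. \<exists>\<tau>>0. \<forall>t. 0 < t \<longrightarrow> t < \<tau> \<longrightarrow> 1 \<le> (deriv \<phi> t)\<^sup>2 * (L * t)" by blast
qed (use KL t0 in \<open>simp_all add: KL_desingularization_def\<close>)


section \<open>Random matrices and measurability\<close>

lemma psd_symmetric_inner: "psd A \<Longrightarrow> (A *v u) \<bullet> w = u \<bullet> (A *v w)"
  unfolding psd_def by (metis dot_lmul_matrix matrix_transpose_mul transpose_matrix_vector vector_transpose_matrix)

lemma loewner_le_scaled_identity:
  assumes "loewner_le A (M *\<^sub>R mat 1)"
  shows "u \<bullet> (A *v u) \<le> M * (norm u)\<^sup>2"
proof -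
  have "0 \<le> u \<bullet> ((M *\<^sub>R mat 1 - A) *v u)" using assms unfolding loewner_le_def psd_def by blast
  also have "(M *\<^sub>R mat 1 - A) *v u = M *\<^sub>R u - A *v u"
    by (simp add: matrix_vector_mult_diff_rdistrib scaleR_matrix_vector_assoc[symmetric])
  finally show ?thesis by (simp add: inner_diff_right power2_norm_eq_inner)
qed

lemma scaled_identity_loewner_le:
  assumes "loewner_le (c *\<^sub>R mat 1) A"
  shows "c * (norm u)\<^sup>2 \<le> u \<bullet> (A *v u)"
proof -
  have "0 \<le> u \<bullet> ((A - c *\<^sub>R mat 1) *v u)" using assms unfolding loewner_le_def psd_def by blast
  also have "(A - c *\<^sub>R mat 1) *v u = A *v u - c *\<^sub>R u"
    by (simp add: matrix_vector_mult_diff_rdistrib scaleR_matrix_vector_assoc[symmetric])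
  finally show ?thesis by (simp add: inner_diff_right power2_norm_eq_inner)
qed

text \<open>Positivity of the quadratic form at \<open>u - A u / M\<close> gives \<open>A\<^sup>2 \<le> M A\<close> without
  square roots of matrices.\<close>

lemma psd_norm_square_le:
  assumes A: "psd A" and le: "loewner_le A (M *\<^sub>R mat 1)" and M: "0 < M"
  shows "(norm (A *v u))\<^sup>2 \<le> M * (u \<bullet> (A *v u))"
proof -
  define b where "b = A *v u"
  define z where "z = u - (1 / M) *\<^sub>R b"
  have Az: "A *v z = b - (1 / M) *\<^sub>R (A *v b)"
    by (simp add: z_def b_def matrix_vector_mult_diff_distrib matrix_vector_mult_scaleR)
  have ub: "u \<bullet> (A *v b) = b \<bullet> b" using psd_symmetric_inner[OF A, of u b] by (simp add: b_def)
  have "0 \<le> z \<bullet> (A *v z)" using A unfolding psd_def by blast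
  also have "\<dots> = u \<bullet> b - 2 / M * (b \<bullet> b) + (1 / M)\<^sup>2 * (b \<bullet> (A *v b))"
    unfolding Az using M by (simp add: z_def inner_diff_left inner_diff_right ub power2_eq_square field_simps)
  also have "b \<bullet> (A *v b) \<le> M * (b \<bullet> b)"
    using loewner_le_scaled_identity[OF le, of b] by (simp add: power2_norm_eq_inner)
  finally have "0 \<le> u \<bullet> b - 2 / M * (b \<bullet> b) + (1 / M)\<^sup>2 * (M * (b \<bullet> b))"
    using M by (simp add: mult_left_mono)
  then have "b \<bullet> b / M \<le> u \<bullet> b" using M by (simp add: power2_eq_square field_simps)
  then show ?thesis using M by (simp add: b_def power2_norm_eq_inner field_simps)
qed

lemma psd_norm_le:
  assumes A: "psd A" and le: "loewner_le A (M *\<^sub>R mat 1)" and M: "0 < M"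
  shows "norm (A *v u) \<le> M * norm u"
proof -
  have "(norm (A *v u))\<^sup>2 \<le> M * (u \<bullet> (A *v u))" using assms by (rule psd_norm_square_le)
  also have "\<dots> \<le> M * (M * (norm u)\<^sup>2)"
    using loewner_le_scaled_identity[OF le, of u] M by (intro mult_left_mono) auto
  also have "\<dots> = (M * norm u)\<^sup>2" by (simp add: power2_eq_square)
  finally show ?thesis using M by (simp add: power2_le_iff_abs_le)
qed

lemma psd_norm_square_eq:
  assumes "psd A"
  shows "(norm (A *v u))\<^sup>2 = u \<bullet> ((A ** A) *v u)"
  using psd_symmetric_inner[OF assms, of u "A *v u"]
  by (simp add: power2_norm_eq_inner matrix_vector_mul_assoc)

text \<open>Bounded entries make the products in the quadratic form of \<open>A ** A\<close>
  integrable, as needed for conditioning entry by entry.\<close>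

lemma psd_square_entry_le:
  assumes A: "psd A" and le: "loewner_le A (M *\<^sub>R mat 1)" and M: "0 < M"
  shows "\<bar>(A ** A) $ i $ j\<bar> \<le> M\<^sup>2"
proof -
  have "(A ** A) $ i $ j = ((A ** A) *v axis j 1) $ i"
    by (simp add: matrix_vector_mult_basis column_def)
  then have "\<bar>(A ** A) $ i $ j\<bar> \<le> norm (A *v (A *v axis j 1))"
    by (metis component_le_norm_cart matrix_vector_mul_assoc)
  also have "\<dots> \<le> M * (M * norm (axis j 1 :: real^'a))"
    using psd_norm_le[OF assms] M by (meson less_imp_le mult_left_mono order_trans)
  finally show ?thesis by (simp add: power2_eq_square)
qed

lemma inner_matrix_vector_eq_sum:
  "u \<bullet> (A *v u) = (\<Sum>i\<in>UNIV. \<Sum>j\<in>UNIV. u $ i * u $ j * A $ i $ j)"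
  for A :: "real^'n::finite^'n"
  by (simp add: inner_vec_def matrix_vector_mult_def sum_distrib_left mult_ac)

text \<open>With \<open>u = - a *\<^sub>R grad f x\<close> the linear and the quadratic term of the
  smoothness bound are multiples of the same quadratic form.\<close>

lemma upper_1_smooth_step:
  assumes smooth: "upper_1_smooth_along f A"
  shows "f (x - a *\<^sub>R (A *v grad f x))
    \<le> f x - a * (1 - a / 2) * (grad f x \<bullet> (A *v grad f x))"
proof -
  have "A *v (- a *\<^sub>R grad f x) = - a *\<^sub>R (A *v grad f x)"
    by (simp only: matrix_vector_mult_scaleR)
  then show ?thesis
    using smooth[unfolded upper_1_smooth_along_def, rule_format, of x "- a *\<^sub>R grad f x"]
    by (simp add: algebra_simps power2_eq_square)
qed

lemma borel_measurable_matrix_vector_mult [measurable (raw)]: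
  fixes A :: "'a \<Rightarrow> real^'n::finite^'m::finite"
  assumes A: "A \<in> borel_measurable N" and w: "w \<in> borel_measurable N"
  shows "(\<lambda>\<omega>. A \<omega> *v w \<omega>) \<in> borel_measurable N"
  using assms
  by (rule borel_measurable_continuous_Pair)
    (unfold matrix_vector_mult_def, intro continuous_intros)

lemma borel_measurable_vec_nth [measurable (raw)]:
  "w \<in> borel_measurable N \<Longrightarrow> (\<lambda>\<omega>. (w \<omega> :: 'b::topological_space^'n) $ i) \<in> borel_measurable N"
  by (rule borel_measurable_continuous_on[of "\<lambda>w. w $ i"]) (intro continuous_intros)

text \<open>Turns an almost sure \<open>eventually\<close> into one measurable random index: the
  least valid threshold, with value \<open>\<infinity>\<close> on the exceptional null set.\<close>

lemma exists_measurable_threshold: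
  fixes N :: "'a measure"
  assumes [measurable]: "\<And>k. Measurable.pred N (Q k)"
    and ev: "AE \<omega> in N. eventually (\<lambda>k. Q k \<omega>) sequentially"
  shows "\<exists>K :: 'a \<Rightarrow> enat. K \<in> measurable N (count_space UNIV) \<and> (AE \<omega> in N. K \<omega> < \<infinity>)
    \<and> (AE \<omega> in N. \<forall>k. K \<omega> \<le> enat k \<longrightarrow> Q k \<omega>)"
proof -
  define K where "K \<omega> = (if \<exists>n. \<forall>k\<ge>n. Q k \<omega> then enat (LEAST n. \<forall>k\<ge>n. Q k \<omega>) else \<infinity>)" for \<omega>
  have "K \<in> measurable N (count_space UNIV)" unfolding K_def[abs_def] by measurable
  moreover have "AE \<omega> in N. K \<omega> < \<infinity>"
    using ev by eventually_elim (simp add: K_def eventually_sequentially)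
  moreover have "AE \<omega> in N. \<forall>k. K \<omega> \<le> enat k \<longrightarrow> Q k \<omega>"
    using ev
  proof eventually_elim
    case (elim \<omega>)
    then have ex: "\<exists>n. \<forall>k\<ge>n. Q k \<omega>" by (simp add: eventually_sequentially)
    then have "K \<omega> = enat (LEAST n. \<forall>k\<ge>n. Q k \<omega>)" by (simp only: K_def if_True)
    with LeastI_ex[OF ex] show ?case by (simp only: enat_ord_simps)
  qed
  ultimately show ?thesis by blast
qed

text \<open>The chord of the convex exponential over \<open>[- ln 2, 0]\<close>, whose end values
  are \<open>1 / 2\<close> and \<open>1\<close>.\<close>

lemma exp_minus_ln2_times_le: "exp (- ln 2 * y) \<le> 1 - y / 2" if "0 \<le> y" "y \<le> 1" for y :: real
proof -
  have "exp ((1 - y) *\<^sub>R 0 + y *\<^sub>R (- ln 2)) \<le> (1 - y) * exp 0 + y * exp (- ln 2 :: real)"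
    using that by (intro convex_onD[OF exp_convex]) auto
  then show ?thesis by (simp add: exp_minus mult.commute)
qed


section \<open>The randomized subspace descent process\<close>

locale grsd_process = prob_space P + KL_function \<phi> t0 + filtration "space P" F
  for P :: "'a measure" and \<phi> :: "real \<Rightarrow> real" and t0 :: real and F :: "nat \<Rightarrow> 'a measure" +
  fixes f :: "real^'d::finite \<Rightarrow> real" and x0 :: "real^'d"
    and \<alpha> :: "nat \<Rightarrow> real" and \<alpha>_bar :: real
    and B :: "nat \<Rightarrow> 'a \<Rightarrow> real^'d^'d" and M \<nu> :: real
  assumes subalg: "\<And>k. subalgebra P (F k)"
    and B_meas: "\<And>k. B k \<in> borel_measurable (F (Suc k))"
    and B_psd: "\<And>k \<omega>. \<omega> \<in> space P \<Longrightarrow> psd (B k \<omega>)"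
    and B_le: "\<And>k. AE \<omega> in P. loewner_le (B k \<omega>) (M *\<^sub>R mat 1)"
    and B_cond: "\<And>k. AE \<omega> in P.
        loewner_le (\<nu> *\<^sub>R mat 1) (cond_exp_matrix P (F k) (\<lambda>\<omega>'. B k \<omega>' ** B k \<omega>') \<omega>)"
    and C1: "C1_fun f" and coer: "coercive f"
    and KL_ineq: "\<And>y. min_value f < f y \<Longrightarrow>
        1 \<le> deriv \<phi> (f y - min_value f) * norm (grad f y)"
    and step_pos: "\<And>k. 0 < \<alpha> k" and step_le: "\<And>k. \<alpha> k \<le> \<alpha>_bar" and step_lt_2: "\<alpha>_bar < 2"
    and step_sum: "filterlim (\<lambda>n. \<Sum>k<n. \<alpha> k) at_top sequentially"
    and smooth: "\<And>k \<omega>. \<omega> \<in> space P \<Longrightarrow> upper_1_smooth_along f (B k \<omega>)"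
    and M_pos: "0 < M" and \<nu>_pos: "0 < \<nu>"
begin

definition "X k \<omega> = grsd f \<alpha> B x0 k \<omega>"
definition "r k \<omega> = f (X k \<omega>) - min_value f"
definition "G k \<omega> = grad f (X k \<omega>)"
definition "v k \<omega> = norm (B k \<omega> *v G k \<omega>)"
definition "c1 = (1 - \<alpha>_bar / 2) / M"
definition "A k = (\<Sum>i<k. \<alpha> i)"

text \<open>The choice of the unit vector where the gradient vanishes is arbitrary, but it keeps
  \<open>\<nu>\<close> a lower bound of the conditional expectation of \<open>\<zeta> k\<close> there.\<close>

definition "U k \<omega> = (if G k \<omega> = 0 then axis undefined 1 else (1 / norm (G k \<omega>)) *\<^sub>R G k \<omega>)"
definition "\<zeta> k \<omega> = (norm (B k \<omega> *v U k \<omega>))\<^sup>2"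
definition "S k \<omega> = (\<Sum>i<k. \<alpha> i * \<zeta> i \<omega>)"

text \<open>One event of full probability collects the upper bounds on all matrices, so that the
  descent arguments run path by path. The conditional second moment bound enters only under
  integrals.\<close>

definition "regular \<omega> \<longleftrightarrow> \<omega> \<in> space P \<and> (\<forall>k. loewner_le (B k \<omega>) (M *\<^sub>R mat 1))"

lemma AE_regular: "AE \<omega> in P. regular \<omega>"
  using B_le by (simp add: regular_def AE_all_countable)

lemma c1_pos: "0 < c1"
  using M_pos step_lt_2 by (simp add: c1_def)

lemma step_bar_pos: "0 < \<alpha>_bar"
  using step_pos[of 0] step_le[of 0] by linarith

lemma A_nonneg: "0 \<le> A k"
  unfolding A_def by (intro sum_nonneg) (simp add: step_pos less_imp_le)

lemma A_mono: "k \<le> l \<Longrightarrow> A k \<le> A l"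
  unfolding A_def by (intro sum_mono2) (auto simp: step_pos less_imp_le)

lemma A_at_top: "filterlim A at_top sequentially"
  using step_sum by (simp add: A_def[abs_def])

lemma X_0: "X 0 \<omega> = x0"
  by (simp add: X_def)

lemma X_Suc: "X (Suc k) \<omega> = X k \<omega> - \<alpha> k *\<^sub>R (B k \<omega> *v G k \<omega>)"
  by (simp add: X_def G_def)

lemma f_continuous: "continuous_on UNIV f"
  using C1 by (rule C1_fun_continuous_on)

lemma minimizer: obtains z where "min_value f = f z" "\<And>y. f z \<le> f y"
proof -
  obtain z where "\<forall>y. f z \<le> f y" using coercive_attains_minimum[OF coer f_continuous] by blast
  with min_value_eq[of f z] that[of z] show thesis by simp
qed

lemma min_value_le: "min_value f \<le> f y"
  using minimizer by metis

lemma r_nonneg: "0 \<le> r k \<omega>"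
  by (simp add: r_def min_value_le)

section \<open>Descent along a single path\<close>

lemma quadratic_nonneg: "\<omega> \<in> space P \<Longrightarrow> 0 \<le> u \<bullet> (B k \<omega> *v u)"
  using B_psd unfolding psd_def by blast

lemma r_step:
  assumes "\<omega> \<in> space P"
  shows "r (Suc k) \<omega> \<le> r k \<omega> - \<alpha> k * (1 - \<alpha> k / 2) * (G k \<omega> \<bullet> (B k \<omega> *v G k \<omega>))"
  using upper_1_smooth_step[OF smooth[OF assms, of k], of "X k \<omega>" "\<alpha> k"]
  by (simp add: r_def X_Suc G_def)

lemma r_Suc_le:
  assumes "\<omega> \<in> space P"
  shows "r (Suc k) \<omega> \<le> r k \<omega>"
proof -
  have "0 \<le> \<alpha> k * (1 - \<alpha> k / 2)"
    using step_pos[of k] step_le[of k] step_lt_2 by (intro mult_nonneg_nonneg) auto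
  with quadratic_nonneg[OF assms, of "G k \<omega>" k]
  have "0 \<le> \<alpha> k * (1 - \<alpha> k / 2) * (G k \<omega> \<bullet> (B k \<omega> *v G k \<omega>))" by (rule mult_nonneg_nonneg[rotated])
  with r_step[OF assms, of k] show ?thesis by linarith
qed

lemma r_le_r0:
  assumes "\<omega> \<in> space P"
  shows "r k \<omega> \<le> f x0 - min_value f"
  using r_Suc_le[OF assms]
  by (induction k) (auto simp: r_def X_0 intro: order_trans)

text \<open>Smoothness yields a decrease by the quadratic form of \<open>B k\<close>, which is at
  least \<open>(v k \<omega>)\<^sup>2 / M\<close> by \<open>psd_norm_square_le\<close>.\<close>

lemma descent:
  assumes "regular \<omega>"
  shows "c1 * \<alpha> k * (v k \<omega>)\<^sup>2 \<le> r k \<omega> - r (Suc k) \<omega>"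
proof -
  have \<omega>: "\<omega> \<in> space P" and le: "loewner_le (B k \<omega>) (M *\<^sub>R mat 1)"
    using assms by (auto simp: regular_def)
  define q where "q = G k \<omega> \<bullet> (B k \<omega> *v G k \<omega>)"
  have q: "0 \<le> q" using quadratic_nonneg[OF \<omega>] by (simp add: q_def)
  have "(v k \<omega>)\<^sup>2 \<le> M * q"
    unfolding v_def q_def using psd_norm_square_le[OF B_psd[OF \<omega>] le M_pos] .
  then have "c1 * (v k \<omega>)\<^sup>2 \<le> c1 * (M * q)" using c1_pos by (intro mult_left_mono) auto
  also have "\<dots> = (1 - \<alpha>_bar / 2) * q" using M_pos by (simp add: c1_def)
  also have "\<dots> \<le> (1 - \<alpha> k / 2) * q" using step_le[of k] q by (intro mult_right_mono) auto
  finally have "\<alpha> k * (c1 * (v k \<omega>)\<^sup>2) \<le> \<alpha> k * ((1 - \<alpha> k / 2) * q)"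
    using step_pos[of k] by (intro mult_left_mono) auto
  with r_step[OF \<omega>, of k] show ?thesis by (simp add: q_def mult_ac)
qed

lemma KL_r: "0 < r k \<omega> \<Longrightarrow> 1 \<le> deriv \<phi> (r k \<omega>) * norm (G k \<omega>)"
  using KL_ineq[of "X k \<omega>"] by (simp add: r_def G_def)

lemma G_nonzero: "0 < r k \<omega> \<Longrightarrow> G k \<omega> \<noteq> 0"
  using KL_r[of k \<omega>] by auto

lemma v_zero:
  assumes "regular \<omega>" "r k \<omega> = 0"
  shows "v k \<omega> = 0"
proof -
  have "c1 * \<alpha> k * (v k \<omega>)\<^sup>2 \<le> 0" using descent[OF assms(1), of k] r_nonneg[of "Suc k" \<omega>] assms(2) by linarith
  then show ?thesis using c1_pos step_pos[of k] by (simp add: mult_le_0_iff not_le)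
qed

lemma norm_U: "norm (U k \<omega>) = 1"
  by (simp add: U_def)

lemma \<zeta>_nonneg: "0 \<le> \<zeta> k \<omega>"
  by (simp add: \<zeta>_def)

lemma \<zeta>_le:
  assumes "regular \<omega>"
  shows "\<zeta> k \<omega> \<le> M\<^sup>2"
proof -
  have "norm (B k \<omega> *v U k \<omega>) \<le> M * norm (U k \<omega>)"
    using assms B_psd M_pos by (intro psd_norm_le) (auto simp: regular_def)
  then show ?thesis by (simp add: \<zeta>_def norm_U power_mono)
qed

lemma S_nonneg: "0 \<le> S k \<omega>"
  unfolding S_def by (intro sum_nonneg mult_nonneg_nonneg) (auto simp: step_pos less_imp_le \<zeta>_nonneg)

lemma S_mono: "k \<le> l \<Longrightarrow> S k \<omega> \<le> S l \<omega>"
  unfolding S_def by (intro sum_mono2 mult_nonneg_nonneg) (auto simp: step_pos less_imp_le \<zeta>_nonneg)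

lemma v_square_eq: "(v k \<omega>)\<^sup>2 = (norm (G k \<omega>))\<^sup>2 * \<zeta> k \<omega>"
  by (cases "G k \<omega> = 0")
    (simp_all add: v_def \<zeta>_def U_def matrix_vector_mult_scaleR power_mult_distrib power_divide)

text \<open>The squared Kurdyka--Lojasiewicz inequality cancels the gradient norm in the decrease,
  leaving only \<open>\<zeta>\<close>; monotonicity of the integrand converts the decrease of
  \<open>r\<close> into growth of \<open>Psi\<close>. Positivity is required because psi is infinite
  at zero.\<close>

lemma Psi_r_step:
  assumes reg: "regular \<omega>" and pos: "0 < r (Suc k) \<omega>"
  shows "Psi (r k \<omega>) + c1 * \<alpha> k * \<zeta> k \<omega> \<le> Psi (r (Suc k) \<omega>)"
proof -
  have \<omega>: "\<omega> \<in> space P" using reg by (simp add: regular_def)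
  note le = r_Suc_le[OF \<omega>, of k]
  have rk: "0 < r k \<omega>" using pos le by linarith
  define p where "p = deriv \<phi> (r k \<omega>)"
  have "1 \<le> (p * norm (G k \<omega>))\<^sup>2" using KL_r[OF rk] by (simp add: p_def)
  then have "c1 * \<alpha> k * \<zeta> k \<omega> * 1 \<le> c1 * \<alpha> k * \<zeta> k \<omega> * (p * norm (G k \<omega>))\<^sup>2"
    using c1_pos step_pos[of k] \<zeta>_nonneg[of k \<omega>] by (intro mult_left_mono) auto
  also have "\<dots> = p\<^sup>2 * (c1 * \<alpha> k * (v k \<omega>)\<^sup>2)"
    by (simp add: v_square_eq power_mult_distrib)
  also have "\<dots> \<le> p\<^sup>2 * (r k \<omega> - r (Suc k) \<omega>)"
    using descent[OF reg] by (intro mult_left_mono) auto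
  also have "\<dots> \<le> Psi (r (Suc k) \<omega>) - Psi (r k \<omega>)"
    unfolding p_def using pos le by (rule Psi_diff_ge)
  finally show ?thesis by simp
qed

lemma r_pos_earlier:
  assumes "\<omega> \<in> space P" "0 < r (Suc k) \<omega>"
  shows "0 < r k \<omega>"
  using r_Suc_le[OF assms(1), of k] assms(2) by linarith

lemma Psi_r_ge:
  assumes reg: "regular \<omega>" and pos: "0 < r k \<omega>"
  shows "Psi (f x0 - min_value f) + c1 * S k \<omega> \<le> Psi (r k \<omega>)"
  using pos
proof (induction k)
  case 0
  then show ?case by (simp add: S_def r_def X_0)
next
  case (Suc k)
  have "0 < r k \<omega>" using r_pos_earlier Suc.prems reg by (auto simp: regular_def)
  from Suc.IH[OF this] Psi_r_step[OF reg Suc.prems] show ?case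
    by (simp add: S_def algebra_simps)
qed

section \<open>The comparison sequence and pathwise convergence\<close>

text \<open>The deterministic rate of the pathwise bounds. It starts at \<open>t0\<close> rather
  than at the initial gap; the resulting offset in psi is absorbed for large
  \<open>k\<close>.\<close>

definition "t k = KL_psi_inv \<phi> t0 (ereal (c1 * \<nu> / 2 * A k))"

lemma t_arg_nonneg: "Psi t0 \<le> c1 * \<nu> / 2 * A k"
  using c1_pos \<nu>_pos A_nonneg[of k] by (simp add: Psi_t0)

lemma t_pos: "0 < t k" and Psi_t: "Psi (t k) = c1 * \<nu> / 2 * A k"
  unfolding t_def using KL_psi_inv_pos_Psi[OF t0_pos t_arg_nonneg] by auto

lemma Psi_t_Suc: "Psi (t (Suc k)) - Psi (t k) = c1 * \<nu> / 2 * \<alpha> k"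
  by (simp add: Psi_t A_def algebra_simps)

lemma t_Suc_le: "t (Suc k) \<le> t k"
proof -
  have "c1 * \<nu> / 2 * A k \<le> c1 * \<nu> / 2 * A (Suc k)"
    using c1_pos \<nu>_pos A_mono[of k "Suc k"] by (intro mult_left_mono) auto
  then show ?thesis using Psi_le_iff[OF t_pos t_pos, of k "Suc k"] by (simp add: Psi_t)
qed

lemma t_tendsto_0: "t \<longlonglongrightarrow> 0"
  unfolding t_def[abs_def]
  by (intro KL_psi_inv_tendsto_0 filterlim_tendsto_pos_mult_at_top[OF tendsto_const _ A_at_top])
    (use c1_pos \<nu>_pos in simp)

text \<open>The surplus \<open>\<eta> - 1 / 2\<close> multiplies the divergent \<open>A k\<close>
  and so eventually outweighs every fixed loss.\<close>

lemma r_le_t_Suc_eventually: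
  assumes reg: "regular \<omega>" and \<eta>: "1 / 2 < \<eta>"
    and S: "eventually (\<lambda>k. \<eta> * \<nu> * (A k - 1) \<le> S k \<omega>) sequentially"
  shows "eventually (\<lambda>k. r k \<omega> \<le> t (Suc k)) sequentially"
proof -
  \<comment> \<open>The value of \<open>A k\<close> at which the surplus covers the three fixed
    losses: one stepsize for the index shift, the \<open>1\<close> subtracted from
    \<open>A k\<close>, and the initial value of \<open>Psi\<close>.\<close>
  define K where "K = (c1 * \<nu> / 2 * \<alpha>_bar + c1 * \<eta> * \<nu> - Psi (f x0 - min_value f)) / (c1 * \<nu> * (\<eta> - 1 / 2))"
  have pos: "0 < c1 * \<nu> * (\<eta> - 1 / 2)" using c1_pos \<nu>_pos \<eta> by simp
  have "eventually (\<lambda>k. K \<le> A k) sequentially"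
    using A_at_top unfolding filterlim_at_top by blast
  with S show ?thesis
  proof eventually_elim
    case (elim k)
    have *: "c1 * \<nu> / 2 * \<alpha>_bar + c1 * \<eta> * \<nu> - Psi (f x0 - min_value f) \<le> A k * (c1 * \<nu> * (\<eta> - 1 / 2))"
      using elim(2) pos unfolding K_def by (simp only: pos_divide_le_eq)
    have "c1 * (\<eta> * \<nu> * (A k - 1)) \<le> c1 * S k \<omega>" using elim(1) c1_pos by (intro mult_left_mono) auto
    moreover have "c1 * \<nu> / 2 * A (Suc k) \<le> c1 * \<nu> / 2 * (A k + \<alpha>_bar)"
      using step_le[of k] c1_pos \<nu>_pos by (intro mult_left_mono) (auto simp: A_def)
    ultimately have "c1 * \<nu> / 2 * A (Suc k) \<le> Psi (f x0 - min_value f) + c1 * S k \<omega>"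
      using * by (simp add: algebra_simps)
    then show ?case
      unfolding t_def using Psi_r_ge[OF reg, of k]
      by (intro le_KL_psi_inv[OF t0_pos t_arg_nonneg]) simp
  qed
qed

lemma X_diff_le:
  assumes reg: "regular \<omega>" and le: "\<And>i. k \<le> i \<Longrightarrow> r i \<omega> \<le> t (Suc i)" and kn: "k \<le> n"
  shows "norm (X n \<omega> - X k \<omega>) \<le> sqrt 2 / (c1 * sqrt \<nu>) * \<phi> (t k)"
proof -
  have "norm (X n \<omega> - X k \<omega>) = norm (\<Sum>i = k..<n. X (Suc i) \<omega> - X i \<omega>)"
    using sum_Suc_diff'[OF kn, of "\<lambda>i. X i \<omega>"] by simp
  also have "\<dots> \<le> (\<Sum>i = k..<n. \<alpha> i * v i \<omega>)"
    by (rule sum_norm_le) (simp add: X_Suc v_def step_pos less_imp_le)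
  also have "\<dots> \<le> sqrt 2 / (c1 * sqrt \<nu>) * \<phi> (t k)"
    using c1_pos \<nu>_pos step_pos t_pos Psi_t_Suc r_nonneg le descent[OF reg]
    by (intro path_length_bound[where r = "\<lambda>i. r i \<omega>"]) auto
  finally show ?thesis .
qed

text \<open>The bound on the remaining length tends to zero, hence the path is Cauchy; the squeezed
  gap makes its limit a minimizer, and the same bound passes to the limit as the rate.\<close>

lemma convergent_path:
  assumes reg: "regular \<omega>" and ev: "eventually (\<lambda>k. r k \<omega> \<le> t (Suc k)) sequentially"
  obtains L where "(\<lambda>k. X k \<omega>) \<longlonglongrightarrow> L" "f L = min_value f"
    "eventually (\<lambda>k. norm (X k \<omega> - L) \<le> sqrt 2 / (c1 * sqrt \<nu>) * \<phi> (t k)) sequentially"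
proof -
  define C where "C = sqrt 2 / (c1 * sqrt \<nu>)"
  obtain K where K: "\<And>k. K \<le> k \<Longrightarrow> r k \<omega> \<le> t (Suc k)"
    using ev unfolding eventually_sequentially by blast
  have bound: "norm (X n \<omega> - X k \<omega>) \<le> C * \<phi> (t k)" if "K \<le> k" "k \<le> n" for k n
    unfolding C_def using that K by (intro X_diff_le[OF reg]) auto
  \<comment> \<open>\<open>\<phi>\<close> is continuous only on the closed half line; composing with
    \<open>max 0\<close> gives a function continuous everywhere that agrees with it along the
    positive sequence \<open>t\<close>.\<close>
  have "(\<lambda>k. C * \<phi> (max 0 (t k))) \<longlonglongrightarrow> C * 0"
    by (intro tendsto_intros tendsto_comp_0 t_tendsto_0)
  then have lim0: "(\<lambda>k. C * \<phi> (t k)) \<longlonglongrightarrow> 0"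
    using t_pos by (simp add: max_absorb2 less_imp_le)
  have "Cauchy (\<lambda>k. X k \<omega>)"
  proof (rule metric_CauchyI)
    fix e :: real assume e: "0 < e"
    have "eventually (\<lambda>k. C * \<phi> (t k) < e) sequentially" using lim0 e by (rule order_tendstoD)
    then obtain N where N: "\<And>k. N \<le> k \<Longrightarrow> C * \<phi> (t k) < e" unfolding eventually_sequentially by blast
    have "dist (X m \<omega>) (X n \<omega>) < e" if "max N K \<le> m" "m \<le> n" for m n
      using that bound[of m n] N[of m] by (simp add: dist_norm norm_minus_commute)
    then show "\<exists>N. \<forall>m\<ge>N. \<forall>n\<ge>N. dist (X m \<omega>) (X n \<omega>) < e"
      by (intro exI[of _ "max N K"]) (metis dist_commute linorder_linear)
  qed
  then obtain L where L: "(\<lambda>k. X k \<omega>) \<longlonglongrightarrow> L"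
    using Cauchy_convergent_iff convergent_def by blast
  have "norm (X k \<omega> - L) \<le> C * \<phi> (t k)" if k: "K \<le> k" for k
  proof (rule tendsto_upperbound)
    show "(\<lambda>n. norm (X k \<omega> - X n \<omega>)) \<longlonglongrightarrow> norm (X k \<omega> - L)" by (intro tendsto_intros L)
    show "eventually (\<lambda>n. norm (X k \<omega> - X n \<omega>) \<le> C * \<phi> (t k)) sequentially"
      using bound[OF k] by (intro eventually_sequentiallyI[of k]) (simp add: norm_minus_commute)
  qed simp
  moreover have "f L = min_value f"
  proof -
    have "(\<lambda>k. r k \<omega>) \<longlonglongrightarrow> f L - min_value f"
      unfolding r_def
      by (intro tendsto_intros continuous_on_tendsto_compose[OF f_continuous L]) auto
    moreover have "(\<lambda>k. r k \<omega>) \<longlonglongrightarrow> 0"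
      using tendsto_sandwich[OF _ ev tendsto_const LIMSEQ_Suc[OF t_tendsto_0]] r_nonneg by simp
    ultimately show ?thesis using LIMSEQ_unique by fastforce
  qed
  ultimately show thesis
    using that[OF L] unfolding C_def by (metis (no_types, lifting) eventually_sequentiallyI)
qed

section \<open>Adaptedness and measurability\<close>

lemma measurable_F_mono: "i \<le> j \<Longrightarrow> w \<in> measurable (F i) N \<Longrightarrow> w \<in> measurable (F j) N"
  using sets_F_mono[of i j] space_F by (intro measurable_from_subalg[of "F j" "F i"]) (auto simp: subalgebra_def)

lemma measurable_F_P: "w \<in> measurable (F k) N \<Longrightarrow> w \<in> measurable P N"
  by (rule measurable_from_subalg[OF subalg])

lemma B_measurable_P [measurable]: "B k \<in> borel_measurable P"
  by (rule measurable_F_P[OF B_meas])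

lemma grad_measurable: "grad f \<in> borel_measurable borel"
  using C1 unfolding C1_fun_def by (intro borel_measurable_continuous_onI) simp

lemma X_meas: "X k \<in> borel_measurable (F k)"
proof (induction k)
  case 0
  show ?case by (simp add: X_0[abs_def])
next
  case (Suc k)
  have [measurable]: "X k \<in> borel_measurable (F (Suc k))"
    using Suc by (rule measurable_F_mono[rotated]) simp
  note B_meas[measurable] grad_measurable[measurable]
  show ?case unfolding X_Suc[abs_def] G_def by measurable
qed

lemma G_meas: "G k \<in> borel_measurable (F k)"
  unfolding G_def[abs_def] using X_meas grad_measurable by (rule measurable_compose)

lemma U_meas: "U k \<in> borel_measurable (F k)"
proof -
  note G_meas[measurable]
  show ?thesis unfolding U_def[abs_def] by measurable
qed

text \<open>The sum stops before \<open>k\<close>, and \<open>B i\<close> is known at time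
  \<open>Suc i\<close>; hence \<open>S k\<close> may serve as a weight when conditioning on
  \<open>F k\<close>.\<close>

lemma S_meas: "S k \<in> borel_measurable (F k)"
proof -
  have "(\<lambda>\<omega>. \<alpha> i * \<zeta> i \<omega>) \<in> borel_measurable (F k)" if "i < k" for i
  proof -
    have [measurable]: "B i \<in> borel_measurable (F k)"
      using B_meas that by (intro measurable_F_mono[of "Suc i" k]) auto
    have [measurable]: "U i \<in> borel_measurable (F k)"
      using U_meas that by (intro measurable_F_mono[of i k]) auto
    show ?thesis unfolding \<zeta>_def by measurable
  qed
  then show ?thesis unfolding S_def[abs_def] by (intro borel_measurable_sum) simp
qed

lemmas X_measurable_P [measurable] = measurable_F_P[OF X_meas]
lemmas G_measurable_P [measurable] = measurable_F_P[OF G_meas]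
lemmas U_measurable_P [measurable] = measurable_F_P[OF U_meas]
lemmas S_measurable_P [measurable] = measurable_F_P[OF S_meas]

lemma r_measurable [measurable]: "r k \<in> borel_measurable P"
proof -
  have [measurable]: "f \<in> borel_measurable borel"
    using f_continuous by (rule borel_measurable_continuous_onI)
  show ?thesis unfolding r_def[abs_def] by measurable
qed

section \<open>Second moments and Chernoff bounds\<close>

lemma integrable_bounded:
  fixes h :: "'a \<Rightarrow> 'c::{banach, second_countable_topology}"
  assumes "h \<in> borel_measurable P" "AE \<omega> in P. norm (h \<omega>) \<le> K"
  shows "integrable P h"
  using assms by (rule integrable_const_bound[rotated])

text \<open>The integrand is a quadratic form in \<open>B k ** B k\<close>. Its coefficients
  \<open>w $ i * w $ j\<close> are bounded and known at time \<open>k\<close>, so each entry may be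
  replaced by its conditional expectation. The Loewner bound then applies to the random vector
  \<open>w\<close>, since at almost every point it holds for all vectors at once.\<close>

lemma second_moment_ge:
  assumes w: "w \<in> borel_measurable (F k)" and bound: "\<And>\<omega>. \<omega> \<in> space P \<Longrightarrow> norm (w \<omega>) \<le> K"
  shows "\<nu> * (\<integral>\<omega>. (norm (w \<omega>))\<^sup>2 \<partial>P) \<le> (\<integral>\<omega>. (norm (B k \<omega> *v w \<omega>))\<^sup>2 \<partial>P)"
proof -
  interpret sub: finite_measure_subalgebra P "F k" by unfold_locales (rule subalg)
  note wP[measurable] = measurable_F_P[OF w]
  define E where "E i j \<omega> = (B k \<omega> ** B k \<omega>) $ i $ j" for i j \<omega>
  have E_meas[measurable]: "E i j \<in> borel_measurable P" for i j
    unfolding E_def[abs_def] matrix_matrix_mult_def by simp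
  have E_le: "AE \<omega> in P. \<bar>E i j \<omega>\<bar> \<le> M\<^sup>2" for i j
    using AE_regular
    by eventually_elim (auto simp: E_def regular_def intro!: psd_square_entry_le B_psd M_pos)
  have ww_meas: "(\<lambda>\<omega>. w \<omega> $ i * w \<omega> $ j) \<in> borel_measurable (F k)" for i j
    using w by measurable
  have int: "integrable P (\<lambda>\<omega>. (w \<omega> $ i * w \<omega> $ j) * E i j \<omega>)" for i j
  proof (rule integrable_bounded)
    show "AE \<omega> in P. norm ((w \<omega> $ i * w \<omega> $ j) * E i j \<omega>) \<le> (K * K) * M\<^sup>2"
      using E_le[of i j] AE_space
    proof eventually_elim
      case (elim \<omega>)
      have "\<bar>w \<omega> $ l\<bar> \<le> K" for l
        using component_le_norm_cart[of "w \<omega>" l] bound[OF elim(2)] by linarith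
      then show ?case
        unfolding real_norm_def abs_mult using elim(1)
        by (intro mult_mono) (auto intro: order_trans[OF abs_ge_zero])
    qed
  qed measurable
  note ce = sub.real_cond_exp_intg[OF int ww_meas E_meas]
  have "(\<integral>\<omega>. (norm (B k \<omega> *v w \<omega>))\<^sup>2 \<partial>P) = (\<integral>\<omega>. (\<Sum>i\<in>UNIV. \<Sum>j\<in>UNIV. (w \<omega> $ i * w \<omega> $ j) * E i j \<omega>) \<partial>P)"
    by (intro Bochner_Integration.integral_cong refl)
      (simp add: psd_norm_square_eq[OF B_psd] inner_matrix_vector_eq_sum E_def)
  also have "\<dots> = (\<Sum>i\<in>UNIV. \<Sum>j\<in>UNIV. \<integral>\<omega>. (w \<omega> $ i * w \<omega> $ j) * E i j \<omega> \<partial>P)"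
    by (simp add: int)
  also have "\<dots> = (\<Sum>i\<in>UNIV. \<Sum>j\<in>UNIV. \<integral>\<omega>. (w \<omega> $ i * w \<omega> $ j) * real_cond_exp P (F k) (E i j) \<omega> \<partial>P)"
    by (simp add: ce(2))
  also have "\<dots> = (\<integral>\<omega>. (\<Sum>i\<in>UNIV. \<Sum>j\<in>UNIV. (w \<omega> $ i * w \<omega> $ j) * real_cond_exp P (F k) (E i j) \<omega>) \<partial>P)"
    by (simp add: ce(1))
  also have "\<dots> = (\<integral>\<omega>. w \<omega> \<bullet> (cond_exp_matrix P (F k) (\<lambda>\<omega>'. B k \<omega>' ** B k \<omega>') \<omega> *v w \<omega>) \<partial>P)"
    by (simp add: inner_matrix_vector_eq_sum cond_exp_matrix_def E_def[abs_def])
  also have "\<dots> \<ge> (\<integral>\<omega>. \<nu> * (norm (w \<omega>))\<^sup>2 \<partial>P)"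
  proof (rule integral_mono_AE)
    show "integrable P (\<lambda>\<omega>. \<nu> * (norm (w \<omega>))\<^sup>2)"
      using bound by (intro integrable_mult_right integrable_bounded[of _ "K\<^sup>2"] AE_I2)
        (auto intro: power_mono)
    show "integrable P (\<lambda>\<omega>. w \<omega> \<bullet> (cond_exp_matrix P (F k) (\<lambda>\<omega>'. B k \<omega>' ** B k \<omega>') \<omega> *v w \<omega>))"
      unfolding inner_matrix_vector_eq_sum cond_exp_matrix_def
      by (simp, intro Bochner_Integration.integrable_sum ce(1)[unfolded E_def[abs_def]])
    show "AE \<omega> in P. \<nu> * (norm (w \<omega>))\<^sup>2
        \<le> w \<omega> \<bullet> (cond_exp_matrix P (F k) (\<lambda>\<omega>'. B k \<omega>' ** B k \<omega>') \<omega> *v w \<omega>)"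
      using B_cond[of k] by eventually_elim (rule scaled_identity_loewner_le)
  qed
  finally show ?thesis by simp
qed

text \<open>An almost sure upper bound on a single increment of \<open>S\<close>, used to normalize
  the increments to the unit interval.\<close>

abbreviation "b \<equiv> M\<^sup>2 * \<alpha>_bar"

lemma b_pos: "0 < b"
  using M_pos step_bar_pos by simp

text \<open>Each step multiplies the exponential by at most \<open>1 - y / 2\<close>, where
  \<open>y\<close> is the normalized increment; the lower bound \<open>\<nu>\<close> on the
  conditional mean of \<open>\<zeta>\<close> turns this into a contraction of the
  expectation.\<close>

lemma exp_S_expectation:
  "(\<integral>\<omega>. exp (- ln 2 / b * S k \<omega>) \<partial>P) \<le> exp (- \<nu> / (2 * b) * A k)"
proof (induction k)
  case 0
  then show ?case by (simp add: S_def A_def)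
next
  case (Suc k)
  define Z where "Z l \<omega> = exp (- ln 2 / b * S l \<omega>)" for l \<omega>
  have [measurable]: "Z l \<in> borel_measurable P" for l unfolding Z_def[abs_def] by measurable
  have Z_le: "Z l \<omega> \<le> 1" and Z_pos: "0 < Z l \<omega>" for l \<omega>
    using S_nonneg[of l \<omega>] b_pos by (auto simp: Z_def)
  have Z_int: "integrable P (Z l)" for l
    using Z_le Z_pos by (intro integrable_bounded[of _ 1] AE_I2) (auto simp: less_imp_le)
  \<comment> \<open>Placing the square root of the weight inside the vector turns the weighted bound
    on \<open>\<zeta> k\<close> into an instance of \<open>second_moment_ge\<close>.\<close>
  define w where "w \<omega> = sqrt (Z k \<omega>) *\<^sub>R U k \<omega>" for \<omega>
  have w_meas: "w \<in> borel_measurable (F k)"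
  proof -
    note S_meas[measurable] U_meas[measurable]
    show ?thesis unfolding w_def[abs_def] Z_def by measurable
  qed
  have w_sq: "(norm (w \<omega>))\<^sup>2 = Z k \<omega>" for \<omega>
    using Z_pos[of k \<omega>] by (simp add: w_def norm_U)
  have Bw_sq: "(norm (B k \<omega> *v w \<omega>))\<^sup>2 = Z k \<omega> * \<zeta> k \<omega>" for \<omega>
    using Z_pos[of k \<omega>] by (simp add: w_def \<zeta>_def matrix_vector_mult_scaleR power_mult_distrib)
  have "norm (w \<omega>) \<le> 1" for \<omega>
    using w_sq[of \<omega>] Z_le[of k \<omega>] abs_square_le_1[of "norm (w \<omega>)"] by simp
  from second_moment_ge[OF w_meas this]
  have moment: "\<nu> * (\<integral>\<omega>. Z k \<omega> \<partial>P) \<le> (\<integral>\<omega>. Z k \<omega> * \<zeta> k \<omega> \<partial>P)"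
    by (simp add: w_sq Bw_sq)
  have Z\<zeta>_int: "integrable P (\<lambda>\<omega>. Z k \<omega> * \<zeta> k \<omega>)"
  proof (rule integrable_bounded[of _ "1 * M\<^sup>2"])
    show "AE \<omega> in P. norm (Z k \<omega> * \<zeta> k \<omega>) \<le> 1 * M\<^sup>2"
      using AE_regular
    proof eventually_elim
      case (elim \<omega>)
      then show ?case
        unfolding norm_mult using Z_le[of k \<omega>] Z_pos[of k \<omega>] \<zeta>_le[of \<omega> k] \<zeta>_nonneg[of k \<omega>]
        by (intro mult_mono) auto
    qed
    show "(\<lambda>\<omega>. Z k \<omega> * \<zeta> k \<omega>) \<in> borel_measurable P" unfolding \<zeta>_def by measurable
  qed
  have "(\<integral>\<omega>. Z (Suc k) \<omega> \<partial>P) \<le> (\<integral>\<omega>. Z k \<omega> - \<alpha> k / (2 * b) * (Z k \<omega> * \<zeta> k \<omega>) \<partial>P)"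
  proof (rule integral_mono_AE)
    show "AE \<omega> in P. Z (Suc k) \<omega> \<le> Z k \<omega> - \<alpha> k / (2 * b) * (Z k \<omega> * \<zeta> k \<omega>)"
      using AE_regular
    proof eventually_elim
      case (elim \<omega>)
      define y where "y = \<alpha> k * \<zeta> k \<omega> / b"
      have "\<alpha> k * \<zeta> k \<omega> \<le> \<alpha>_bar * M\<^sup>2"
        using step_le[of k] step_bar_pos \<zeta>_le[OF elim] \<zeta>_nonneg by (intro mult_mono) auto
      then have y: "0 \<le> y" "y \<le> 1"
        using b_pos step_pos[of k] \<zeta>_nonneg[of k \<omega>] by (auto simp: y_def mult.commute)
      have "Z (Suc k) \<omega> = Z k \<omega> * exp (- ln 2 * y)"
        unfolding Z_def y_def exp_add[symmetric] by (simp add: S_def algebra_simps add_divide_distrib)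
      also have "\<dots> \<le> Z k \<omega> * (1 - y / 2)"
        using exp_minus_ln2_times_le[OF y] Z_pos[of k \<omega>] by (intro mult_left_mono) auto
      also have "\<dots> = Z k \<omega> - \<alpha> k / (2 * b) * (Z k \<omega> * \<zeta> k \<omega>)"
        by (simp add: y_def algebra_simps)
      finally show ?case .
    qed
  qed (intro Bochner_Integration.integrable_diff integrable_mult_right Z_int Z\<zeta>_int)+
  also have "\<dots> = (\<integral>\<omega>. Z k \<omega> \<partial>P) - \<alpha> k / (2 * b) * (\<integral>\<omega>. Z k \<omega> * \<zeta> k \<omega> \<partial>P)"
    using Z_int Z\<zeta>_int by simp
  also have "\<dots> \<le> (\<integral>\<omega>. Z k \<omega> \<partial>P) - \<alpha> k / (2 * b) * (\<nu> * (\<integral>\<omega>. Z k \<omega> \<partial>P))"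
    using moment step_pos[of k] b_pos by (intro diff_left_mono mult_left_mono) auto
  also have "\<dots> = (1 + (- \<nu> / (2 * b) * \<alpha> k)) * (\<integral>\<omega>. Z k \<omega> \<partial>P)"
    by (simp add: algebra_simps)
  also have "\<dots> \<le> exp (- \<nu> / (2 * b) * \<alpha> k) * (\<integral>\<omega>. Z k \<omega> \<partial>P)"
    using Z_pos by (intro mult_right_mono exp_ge_add_one_self Bochner_Integration.integral_nonneg) (auto simp: less_imp_le)
  also have "\<dots> \<le> exp (- \<nu> / (2 * b) * \<alpha> k) * exp (- \<nu> / (2 * b) * A k)"
    using Suc by (intro mult_left_mono) (auto simp: Z_def)
  also have "\<dots> = exp (- \<nu> / (2 * b) * A (Suc k))"
    unfolding exp_add[symmetric] by (simp add: A_def algebra_simps add_divide_distrib)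
  finally show ?case by (simp add: Z_def)
qed

text \<open>Markov's inequality for the exponential of \<open>S\<close>. The value
  \<open>\<eta> = 1 / 2\<close> produces the constant of the rate in expectation; the exponent is
  nonpositive up to \<open>\<eta> = 1 / (2 * ln 2)\<close>, which leaves room for
  \<open>3 / 5\<close>.\<close>

lemma chernoff_S:
  "prob {\<omega> \<in> space P. S k \<omega> \<le> \<eta> * \<nu> * A k} \<le> exp ((\<eta> * ln 2 - 1 / 2) * (\<nu> / b) * A k)"
proof -
  define Z where "Z \<omega> = exp (- ln 2 / b * S k \<omega>)" for \<omega>
  define c where "c = exp (- ln 2 / b * (\<eta> * \<nu> * A k))"
  have [measurable]: "Z \<in> borel_measurable P" unfolding Z_def[abs_def] by measurable
  have "integrable P Z"
    using S_nonneg b_pos by (intro integrable_bounded[of _ 1] AE_I2) (auto simp: Z_def)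
  have "{\<omega> \<in> space P. S k \<omega> \<le> \<eta> * \<nu> * A k} = {\<omega> \<in> space P. c \<le> Z \<omega>}"
    using b_pos by (auto simp: c_def Z_def mult_le_cancel_left divide_le_cancel)
  also have "prob \<dots> \<le> (\<integral>\<omega>. Z \<omega> \<partial>P) / c"
    using \<open>integrable P Z\<close> by (rule integral_Markov_inequality_measure[where A = "space P"])
      (auto simp: Z_def c_def)
  also have "\<dots> \<le> exp (- \<nu> / (2 * b) * A k) / c"
    using exp_S_expectation[of k] by (intro divide_right_mono) (auto simp: Z_def c_def)
  also have "\<dots> = exp ((\<eta> * ln 2 - 1 / 2) * (\<nu> / b) * A k)"
    unfolding c_def exp_diff[symmetric] by (simp add: algebra_simps)
  finally show ?thesis .
qed

text \<open>The Chernoff bounds need not be summable over all \<open>k\<close>, since \<open>A k\<close> may grow arbitrarily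
  slowly; they are along the first passage times of \<open>A\<close> through the integers, and \<open>S\<close> is
  monotone in between.\<close>

lemma AE_S_large: "AE \<omega> in P. eventually (\<lambda>k. 3 / 5 * \<nu> * (A k - 1) \<le> S k \<omega>) sequentially"
proof -
  define \<kappa> where "\<kappa> n = (LEAST k. real n \<le> A k)" for n :: nat
  have "\<exists>k. real n \<le> A k" for n
    using A_at_top unfolding filterlim_at_top eventually_sequentially by blast
  then have \<kappa>: "real n \<le> A (\<kappa> n)" for n unfolding \<kappa>_def by (rule LeastI_ex)
  have \<kappa>_le: "\<kappa> n \<le> k" if "real n \<le> A k" for n k unfolding \<kappa>_def using that by (rule Least_le)
  define E where "E n = {\<omega> \<in> space P. S (\<kappa> n) \<omega> \<le> 3 / 5 * \<nu> * A (\<kappa> n)}" for n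
  have E_sets: "E n \<in> sets P" for n unfolding E_def by measurable
  define \<delta> where "\<delta> = (1 / 2 - 3 / 5 * ln 2) * (\<nu> / b)"
  \<comment> \<open>\<open>ln 2 \<le> 25 / 36\<close> gives
    \<open>3 / 5 * ln 2 \<le> 5 / 12 < 1 / 2\<close>.\<close>
  have \<delta>: "0 < \<delta>" using ln2_le_25_over_36 \<nu>_pos b_pos by (simp add: \<delta>_def)
  have "prob (E n) \<le> exp (- \<delta>) ^ n" for n
  proof -
    have "prob (E n) \<le> exp ((3 / 5 * ln 2 - 1 / 2) * (\<nu> / b) * A (\<kappa> n))"
      unfolding E_def by (rule chernoff_S)
    also have "(3 / 5 * ln 2 - 1 / 2) * (\<nu> / b) * A (\<kappa> n) = - (\<delta> * A (\<kappa> n))"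
      by (simp only: \<delta>_def) (simp add: algebra_simps)
    also have "exp \<dots> \<le> exp (real n * - \<delta>)"
      using \<kappa>[of n] \<delta> by (simp add: mult.commute mult_left_mono)
    finally show ?thesis by (simp only: exp_of_nat_mult)
  qed
  then have "norm (prob (E n)) \<le> exp (- \<delta>) ^ n" for n by simp
  moreover have "summable (\<lambda>n. exp (- \<delta>) ^ n)" using \<delta> by (intro summable_geometric) simp
  ultimately have summable: "summable (\<lambda>n. prob (E n))"
    using summable_comparison_test'[of "\<lambda>n. exp (- \<delta>) ^ n" 0 "\<lambda>n. prob (E n)"] by simp
  have fin: "emeasure P (E n) < \<infinity>" for n by (simp add: less_top[symmetric])
  have "AE \<omega> in P. eventually (\<lambda>n. \<omega> \<in> space P - E n) sequentially"
    by (rule borel_cantelli_AE1[OF E_sets fin summable])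
  then show ?thesis
  proof eventually_elim
    case (elim \<omega>)
    then obtain N where N: "\<And>n. N \<le> n \<Longrightarrow> \<omega> \<in> space P - E n" unfolding eventually_sequentially by blast
    have "eventually (\<lambda>k. real N \<le> A k) sequentially" using A_at_top unfolding filterlim_at_top by blast
    then show ?case
    proof eventually_elim
      case (elim k)
      \<comment> \<open>The last integer passed by \<open>A\<close> at time \<open>k\<close>;
        rounding down costs the \<open>1\<close> subtracted in the claim.\<close>
      define n where "n = nat \<lfloor>A k\<rfloor>"
      have n: "real n \<le> A k" "A k - 1 \<le> real n" using A_nonneg[of k] by (auto simp: n_def)
      have "N \<le> n" using elim by (simp add: n_def le_nat_floor)
      have "3 / 5 * \<nu> * (A k - 1) \<le> 3 / 5 * \<nu> * A (\<kappa> n)"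
        using n \<kappa>[of n] \<nu>_pos by (intro mult_left_mono) auto
      also have "\<dots> \<le> S (\<kappa> n) \<omega>" using N[OF \<open>N \<le> n\<close>] by (auto simp: E_def)
      also have "\<dots> \<le> S k \<omega>" using \<kappa>_le[OF n(1)] by (rule S_mono)
      finally show ?case .
    qed
  qed
qed

lemma AE_r_le_t_Suc: "AE \<omega> in P. eventually (\<lambda>k. r k \<omega> \<le> t (Suc k)) sequentially"
  using AE_S_large AE_regular by eventually_elim (rule r_le_t_Suc_eventually[where \<eta> = "3 / 5"], auto)

lemma AE_r_le_t: "AE \<omega> in P. eventually (\<lambda>k. r k \<omega> \<le> t k) sequentially"
  using AE_r_le_t_Suc
proof eventually_elim
  case (elim \<omega>)
  then show ?case by eventually_elim (use t_Suc_le order_trans in blast)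
qed

section \<open>The rate of the expected gap\<close>

lemma r_integrable: "integrable P (r k)"
  using r_le_r0 r_nonneg by (intro integrable_bounded[of _ "f x0 - min_value f"] AE_I2) auto

text \<open>On the Chernoff event \<open>E\<close> the gap is bounded by its initial value; off
  \<open>E\<close>, by the inverse of psi at the guaranteed growth.\<close>

lemma expectation_r_le:
  "(\<integral>\<omega>. r k \<omega> \<partial>P)
    \<le> exp (- ((1 - ln 2) / 2) * (\<nu> / b) * A k) * (f x0 - min_value f)
      + KL_psi_inv \<phi> t0 (KL_psi \<phi> t0 (f x0 - min_value f) + ereal (c1 * \<nu> / 2 * A k))"
proof -
  define r0 where "r0 = f x0 - min_value f"
  have r0: "0 \<le> r0" by (simp add: r0_def min_value_le)
  define V where "V = KL_psi_inv \<phi> t0 (KL_psi \<phi> t0 r0 + ereal (c1 * \<nu> / 2 * A k))"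
  define E where "E = {\<omega> \<in> space P. S k \<omega> \<le> 1 / 2 * \<nu> * A k}"
  have E_sets [measurable]: "E \<in> sets P" unfolding E_def by measurable
  have ind_int: "integrable P (\<lambda>\<omega>. r0 * indicator E \<omega>)"
    by (intro integrable_mult_right integrable_real_indicator) (auto simp: less_top[symmetric])
  have r_le: "r k \<omega> \<le> r0" if "\<omega> \<in> space P" for \<omega> using r_le_r0[OF that] by (simp add: r0_def)
  have V: "0 \<le> V \<and> (\<forall>\<omega>. regular \<omega> \<longrightarrow> \<omega> \<notin> E \<longrightarrow> r k \<omega> \<le> V)"
  \<comment> \<open>If the start is already a minimizer, psi is infinite there, so \<open>V\<close>
    is the value \<open>0\<close> of the inverse at infinity and the gap stays zero.\<close>
  proof (cases "r0 = 0")
    case True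
    then show ?thesis using r_le by (force simp: V_def KL_psi_eq KL_psi_inv_infinity regular_def)
  next
    case False
    with r0 have pos: "0 < r0" by simp
    define u where "u = Psi r0 + c1 * \<nu> / 2 * A k"
    have u: "Psi r0 \<le> u" using c1_pos \<nu>_pos A_nonneg[of k] by (simp add: u_def)
    have V_eq: "V = KL_psi_inv \<phi> t0 (ereal u)" using False by (simp add: V_def KL_psi_eq u_def)
    have "r k \<omega> \<le> V" if reg: "regular \<omega>" and "\<omega> \<notin> E" for \<omega>
      unfolding V_eq
    proof (rule le_KL_psi_inv[OF pos u])
      assume "0 < r k \<omega>"
      from Psi_r_ge[OF reg this] have "Psi r0 + c1 * S k \<omega> \<le> Psi (r k \<omega>)" by (simp add: r0_def)
      moreover have "c1 * (1 / 2 * \<nu> * A k) \<le> c1 * S k \<omega>"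
        using that c1_pos by (intro mult_left_mono) (auto simp: E_def regular_def)
      ultimately show "u \<le> Psi (r k \<omega>)" by (simp add: u_def)
    qed
    then show ?thesis using KL_psi_inv_pos_Psi(1)[OF pos u] V_eq by simp
  qed
  have "(\<integral>\<omega>. r k \<omega> \<partial>P) \<le> (\<integral>\<omega>. r0 * indicator E \<omega> + V \<partial>P)"
  proof (rule integral_mono_AE)
    show "AE \<omega> in P. r k \<omega> \<le> r0 * indicator E \<omega> + V"
      using AE_regular by eventually_elim (use V r_le in \<open>force simp: indicator_def regular_def\<close>)
    show "integrable P (\<lambda>\<omega>. r0 * indicator E \<omega> + V)"
      using ind_int by (intro Bochner_Integration.integrable_add) auto
  qed (rule r_integrable)
  also have "\<dots> = r0 * prob E + V"
    using ind_int E_sets by (simp add: Bochner_Integration.integral_add prob_space)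
  also have "\<dots> \<le> r0 * exp ((1 / 2 * ln 2 - 1 / 2) * (\<nu> / b) * A k) + V"
    unfolding E_def using r0 by (intro add_right_mono mult_left_mono chernoff_S)
  also have "(1 / 2 * ln 2 - 1 / 2) * (\<nu> / b) * A k = - ((1 - ln 2) / 2) * (\<nu> / b) * A k"
    by (simp add: algebra_simps diff_divide_distrib)
  finally show ?thesis by (simp add: V_def r0_def mult.commute)
qed

section \<open>Path length in mean\<close>

lemma X_bounded: "\<exists>R. \<forall>k. \<forall>\<omega>\<in>space P. norm (X k \<omega>) \<le> R"
proof -
  have "bounded {y. f y \<le> f x0}"
    using coercive_compact_sublevel[OF coer f_continuous] by (rule compact_imp_bounded)
  then obtain R where "\<And>y. f y \<le> f x0 \<Longrightarrow> norm y \<le> R" unfolding bounded_iff by blast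
  moreover have "f (X k \<omega>) \<le> f x0" if "\<omega> \<in> space P" for k \<omega>
    using r_le_r0[OF that, of k] by (simp add: r_def)
  ultimately show ?thesis by blast
qed

lemma G_bounded: "\<exists>R. \<forall>k. \<forall>\<omega>\<in>space P. norm (G k \<omega>) \<le> R"
proof -
  have "compact (grad f ` {y. f y \<le> f x0})"
    using C1 coercive_compact_sublevel[OF coer f_continuous]
    by (intro compact_continuous_image) (auto simp: C1_fun_def intro: continuous_on_subset)
  then obtain R where "\<forall>z \<in> grad f ` {y. f y \<le> f x0}. norm z \<le> R"
    using compact_imp_bounded bounded_iff by meson
  then have "norm (grad f y) \<le> R" if "f y \<le> f x0" for y using that by simp
  moreover have "f (X k \<omega>) \<le> f x0" if "\<omega> \<in> space P" for k \<omega>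
    using r_le_r0[OF that, of k] by (simp add: r_def)
  ultimately show ?thesis unfolding G_def by blast
qed

lemma \<phi>_r_integrable: "integrable P (\<lambda>\<omega>. \<phi> (r k \<omega>))"
proof (rule integrable_bounded)
  have [measurable]: "(\<lambda>t. \<phi> (max 0 t)) \<in> borel_measurable borel"
    using continuous_on_max by (rule borel_measurable_continuous_onI)
  have "(\<lambda>\<omega>. \<phi> (max 0 (r k \<omega>))) \<in> borel_measurable P"
    by (rule measurable_compose[of "r k" P borel "\<lambda>t. \<phi> (max 0 t)"]) measurable
  then show "(\<lambda>\<omega>. \<phi> (r k \<omega>)) \<in> borel_measurable P"
    using r_nonneg by (simp add: max_absorb2)
  show "AE \<omega> in P. norm (\<phi> (r k \<omega>)) \<le> \<phi> (f x0 - min_value f)"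
    using nonneg[OF r_nonneg] mono[OF r_nonneg r_le_r0] by (intro AE_I2) simp
qed

text \<open>Jensen's inequality by integrating the tangent at the mean. At mean zero a tangent may
  be missing, but then the gap vanishes almost surely.\<close>

lemma expectation_\<phi>_r_le: "(\<integral>\<omega>. \<phi> (r k \<omega>) \<partial>P) \<le> \<phi> (\<integral>\<omega>. r k \<omega> \<partial>P)"
proof -
  define m where "m = (\<integral>\<omega>. r k \<omega> \<partial>P)"
  have "0 \<le> m" unfolding m_def using r_nonneg by (intro Bochner_Integration.integral_nonneg) simp
  show ?thesis
  proof (cases "m = 0")
    case True
    have "AE \<omega> in P. r k \<omega> = 0"
      using True integral_nonneg_eq_0_iff_AE[OF r_integrable, of k] r_nonneg by (simp add: m_def)
    then have "AE \<omega> in P. \<phi> (r k \<omega>) = 0" by eventually_elim (simp add: zero)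
    then have "(\<integral>\<omega>. \<phi> (r k \<omega>) \<partial>P) = 0" by (rule integral_eq_zero_AE)
    then show ?thesis using True by (simp add: m_def zero)
  next
    case False
    with \<open>0 \<le> m\<close> have "0 < m" by simp
    have "(\<integral>\<omega>. \<phi> (r k \<omega>) \<partial>P) \<le> (\<integral>\<omega>. \<phi> m + deriv \<phi> m * (r k \<omega> - m) \<partial>P)"
      using tangent_above[OF \<open>0 < m\<close> r_nonneg]
      by (intro integral_mono \<phi>_r_integrable) (auto intro!: Bochner_Integration.integrable_add
          Bochner_Integration.integrable_diff integrable_mult_right r_integrable)
    also have "\<dots> = \<phi> m" by (simp add: r_integrable prob_space m_def[symmetric])
    finally show ?thesis by (simp add: m_def)
  qed
qed

lemma v_integrable: "integrable P (v k)"
  and G_integrable: "integrable P (\<lambda>\<omega>. norm (G k \<omega>))"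
  and expectation_v_le: "(\<integral>\<omega>. v k \<omega> \<partial>P) \<le> M * (\<integral>\<omega>. norm (G k \<omega>) \<partial>P)"
proof -
  obtain R where R: "\<And>\<omega>. \<omega> \<in> space P \<Longrightarrow> norm (G k \<omega>) \<le> R" using G_bounded by blast
  show G_int: "integrable P (\<lambda>\<omega>. norm (G k \<omega>))"
    using R by (intro integrable_bounded[of _ R] AE_I2) auto
  have le: "AE \<omega> in P. v k \<omega> \<le> M * norm (G k \<omega>)"
    using AE_regular
    by eventually_elim (auto simp: v_def regular_def intro!: psd_norm_le B_psd M_pos)
  show v_int: "integrable P (v k)"
  proof (rule integrable_bounded)
    show "v k \<in> borel_measurable P" unfolding v_def[abs_def] by measurable
    show "AE \<omega> in P. norm (v k \<omega>) \<le> M * R"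
      using le AE_space
    proof eventually_elim
      case (elim \<omega>)
      have "M * norm (G k \<omega>) \<le> M * R" using R[OF elim(2)] M_pos by (intro mult_left_mono) auto
      moreover have "0 \<le> v k \<omega>" by (simp add: v_def)
      ultimately show ?case using elim(1) by simp
    qed
  qed
  have "(\<integral>\<omega>. v k \<omega> \<partial>P) \<le> (\<integral>\<omega>. M * norm (G k \<omega>) \<partial>P)"
    using le v_int G_int by (intro integral_mono_AE integrable_mult_right) auto
  then show "(\<integral>\<omega>. v k \<omega> \<partial>P) \<le> M * (\<integral>\<omega>. norm (G k \<omega>) \<partial>P)" by simp
qed

text \<open>The vector \<open>G / sqrt (norm G)\<close> (zero where \<open>G\<close> vanishes) turns the lower bound on the
  conditional second moment of \<open>B G\<close> into one on the expectation of \<open>(norm (B G))\<^sup>2 / norm G\<close>.\<close>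

lemma expectation_gradient_le:
  "c1 * \<nu> * (\<alpha> k * (\<integral>\<omega>. norm (G k \<omega>) \<partial>P)) \<le> (\<integral>\<omega>. \<phi> (r k \<omega>) \<partial>P) - (\<integral>\<omega>. \<phi> (r (Suc k) \<omega>) \<partial>P)"
proof -
  obtain R where R: "\<And>\<omega>. \<omega> \<in> space P \<Longrightarrow> norm (G k \<omega>) \<le> R" using G_bounded by blast
  define w where "w \<omega> = (1 / sqrt (norm (G k \<omega>))) *\<^sub>R G k \<omega>" for \<omega>
  have w_meas: "w \<in> borel_measurable (F k)"
  proof -
    note G_meas[measurable]
    show ?thesis unfolding w_def[abs_def] by measurable
  qed
  note [measurable] = measurable_F_P[OF w_meas]
  have w_norm: "norm (w \<omega>) = sqrt (norm (G k \<omega>))" for \<omega>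
    by (simp add: w_def real_div_sqrt)
  then have w_sq: "(norm (w \<omega>))\<^sup>2 = norm (G k \<omega>)" for \<omega> by simp
  have Bw_sq: "(norm (B k \<omega> *v w \<omega>))\<^sup>2 = (v k \<omega>)\<^sup>2 / norm (G k \<omega>)" for \<omega>
    by (simp add: w_def v_def matrix_vector_mult_scaleR power_divide)
  have "norm (w \<omega>) \<le> sqrt R" if "\<omega> \<in> space P" for \<omega>
    using R[OF that] by (simp add: w_norm)
  from second_moment_ge[OF w_meas this]
  have moment: "\<nu> * (\<integral>\<omega>. norm (G k \<omega>) \<partial>P) \<le> (\<integral>\<omega>. (norm (B k \<omega> *v w \<omega>))\<^sup>2 \<partial>P)"
    by (simp add: w_sq)
  have pointwise: "c1 * \<alpha> k * (norm (B k \<omega> *v w \<omega>))\<^sup>2 \<le> \<phi> (r k \<omega>) - \<phi> (r (Suc k) \<omega>)"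
    if reg: "regular \<omega>" for \<omega>
  proof (cases "r k \<omega> = 0")
    case True
    then have "r (Suc k) \<omega> = 0"
      using r_Suc_le[of \<omega> k] r_nonneg[of "Suc k" \<omega>] reg by (simp add: regular_def)
    \<comment> \<open>\<open>v k\<close> vanishes here, so the quotient in \<open>Bw_sq\<close> is
      zero whatever the gradient.\<close>
    then show ?thesis using v_zero[OF reg True] True by (simp add: Bw_sq)
  next
    case False
    then have pos: "0 < r k \<omega>" using r_nonneg[of k \<omega>] by simp
    define p where "p = deriv \<phi> (r k \<omega>)"
    have p: "0 < p" using deriv_pos[OF pos] by (simp add: p_def)
    have G: "0 < norm (G k \<omega>)" using G_nonzero[OF pos] by simp
    \<comment> \<open>Replacing the inverse gradient norm by the derivative of \<open>\<phi>\<close>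
      at the gap lets concavity bound the decrease by an increment of \<open>\<phi>\<close>, which
      telescopes.\<close>
    have "1 / norm (G k \<omega>) \<le> p" using KL_r[OF pos] G by (simp add: p_def pos_divide_le_eq)
    then have "(v k \<omega>)\<^sup>2 * (1 / norm (G k \<omega>)) \<le> (v k \<omega>)\<^sup>2 * p" by (rule mult_left_mono) simp
    then have "c1 * \<alpha> k * (norm (B k \<omega> *v w \<omega>))\<^sup>2 \<le> c1 * \<alpha> k * ((v k \<omega>)\<^sup>2 * p)"
      unfolding Bw_sq using c1_pos step_pos[of k] by (intro mult_left_mono) auto
    also have "\<dots> \<le> p * (r k \<omega> - r (Suc k) \<omega>)"
      using mult_left_mono[OF descent[OF reg, of k] less_imp_le[OF p]] by (simp add: mult_ac)
    also have "\<dots> \<le> \<phi> (r k \<omega>) - \<phi> (r (Suc k) \<omega>)"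
      unfolding p_def using r_nonneg pos by (rule increment_ge)
    finally show ?thesis .
  qed
  have c: "0 < c1 * \<alpha> k" using c1_pos step_pos by simp
  have int: "integrable P (\<lambda>\<omega>. c1 * \<alpha> k * (norm (B k \<omega> *v w \<omega>))\<^sup>2)"
  proof (rule Bochner_Integration.integrable_bound)
    show "integrable P (\<lambda>\<omega>. \<phi> (r k \<omega>) - \<phi> (r (Suc k) \<omega>))"
      by (intro Bochner_Integration.integrable_diff \<phi>_r_integrable)
    show "AE \<omega> in P. norm (c1 * \<alpha> k * (norm (B k \<omega> *v w \<omega>))\<^sup>2) \<le> norm (\<phi> (r k \<omega>) - \<phi> (r (Suc k) \<omega>))"
      using AE_regular
    proof eventually_elim
      case (elim \<omega>)
      have "0 \<le> c1 * \<alpha> k * (norm (B k \<omega> *v w \<omega>))\<^sup>2" using c by simp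
      with pointwise[OF elim] show ?case by simp
    qed
  qed measurable
  have "c1 * \<alpha> k * (\<nu> * (\<integral>\<omega>. norm (G k \<omega>) \<partial>P)) \<le> c1 * \<alpha> k * (\<integral>\<omega>. (norm (B k \<omega> *v w \<omega>))\<^sup>2 \<partial>P)"
    using moment c by (intro mult_left_mono) auto
  also have "\<dots> = (\<integral>\<omega>. c1 * \<alpha> k * (norm (B k \<omega> *v w \<omega>))\<^sup>2 \<partial>P)" by simp
  also have "\<dots> \<le> (\<integral>\<omega>. \<phi> (r k \<omega>) - \<phi> (r (Suc k) \<omega>) \<partial>P)"
  proof (rule integral_mono_AE[OF int])
    show "AE \<omega> in P. c1 * \<alpha> k * (norm (B k \<omega> *v w \<omega>))\<^sup>2 \<le> \<phi> (r k \<omega>) - \<phi> (r (Suc k) \<omega>)"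
      using AE_regular by eventually_elim (rule pointwise)
  qed (intro Bochner_Integration.integrable_diff \<phi>_r_integrable)
  also have "\<dots> = (\<integral>\<omega>. \<phi> (r k \<omega>) \<partial>P) - (\<integral>\<omega>. \<phi> (r (Suc k) \<omega>) \<partial>P)"
    by (intro Bochner_Integration.integral_diff \<phi>_r_integrable)
  finally show ?thesis by (simp add: mult_ac)
qed

lemma X_integrable: "integrable P (X k)"
proof -
  obtain R where "\<And>\<omega>. \<omega> \<in> space P \<Longrightarrow> norm (X k \<omega>) \<le> R" using X_bounded by blast
  then show ?thesis by (intro integrable_bounded[of _ R] AE_I2) auto
qed

lemma expectation_X_diff_le:
  assumes "k \<le> n"
  shows "(\<integral>\<omega>. norm (X n \<omega> - X k \<omega>) \<partial>P) \<le> M / (c1 * \<nu>) * \<phi> (\<integral>\<omega>. r k \<omega> \<partial>P)"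
proof -
  define C where "C = M / (c1 * \<nu>)"
  have C: "0 < C" using M_pos c1_pos \<nu>_pos by (simp add: C_def)
  have int: "integrable P (\<lambda>\<omega>. norm (X n \<omega> - X k \<omega>))" for n
    by (intro integrable_norm Bochner_Integration.integrable_diff X_integrable)
  \<comment> \<open>The term at \<open>n\<close> is kept so that the induction telescopes; it is
    dropped only afterwards, being nonnegative.\<close>
  have "(\<integral>\<omega>. norm (X n \<omega> - X k \<omega>) \<partial>P) \<le> C * ((\<integral>\<omega>. \<phi> (r k \<omega>) \<partial>P) - (\<integral>\<omega>. \<phi> (r n \<omega>) \<partial>P))"
    using assms
  proof (induction n rule: dec_induct)
    case (step n)
    have "norm (X (Suc n) \<omega> - X k \<omega>) \<le> norm (X n \<omega> - X k \<omega>) + \<alpha> n * v n \<omega>" for \<omega>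
      using norm_triangle_ineq4[of "X n \<omega> - X k \<omega>" "\<alpha> n *\<^sub>R (B n \<omega> *v G n \<omega>)"] step_pos[of n]
      by (simp add: X_Suc v_def algebra_simps)
    then have "(\<integral>\<omega>. norm (X (Suc n) \<omega> - X k \<omega>) \<partial>P) \<le> (\<integral>\<omega>. norm (X n \<omega> - X k \<omega>) + \<alpha> n * v n \<omega> \<partial>P)"
      by (intro integral_mono int Bochner_Integration.integrable_add integrable_mult_right v_integrable)
    also have "\<dots> = (\<integral>\<omega>. norm (X n \<omega> - X k \<omega>) \<partial>P) + \<alpha> n * (\<integral>\<omega>. v n \<omega> \<partial>P)"
      by (simp add: int v_integrable)
    also have "\<alpha> n * (\<integral>\<omega>. v n \<omega> \<partial>P) \<le> \<alpha> n * (M * (\<integral>\<omega>. norm (G n \<omega>) \<partial>P))"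
      using expectation_v_le step_pos[of n] by (intro mult_left_mono) auto
    also have "\<alpha> n * (M * (\<integral>\<omega>. norm (G n \<omega>) \<partial>P)) = C * (c1 * \<nu> * (\<alpha> n * (\<integral>\<omega>. norm (G n \<omega>) \<partial>P)))"
      using c1_pos \<nu>_pos by (simp add: C_def)
    also have "\<dots> \<le> C * ((\<integral>\<omega>. \<phi> (r n \<omega>) \<partial>P) - (\<integral>\<omega>. \<phi> (r (Suc n) \<omega>) \<partial>P))"
      using expectation_gradient_le C by (intro mult_left_mono) auto
    finally show ?case using step.IH by (simp add: algebra_simps)
  qed simp
  also have "\<dots> \<le> C * \<phi> (\<integral>\<omega>. r k \<omega> \<partial>P)"
  proof (rule mult_left_mono)
    have "0 \<le> (\<integral>\<omega>. \<phi> (r n \<omega>) \<partial>P)" using nonneg[OF r_nonneg] by (intro Bochner_Integration.integral_nonneg)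
    with expectation_\<phi>_r_le[of k]
    show "(\<integral>\<omega>. \<phi> (r k \<omega>) \<partial>P) - (\<integral>\<omega>. \<phi> (r n \<omega>) \<partial>P) \<le> \<phi> (\<integral>\<omega>. r k \<omega> \<partial>P)" by linarith
  qed (use C in simp)
  finally show ?thesis by (simp add: C_def)
qed

section \<open>The limit of the iterates\<close>

text \<open>The total operator \<open>lim\<close> gives a random variable defined and measurable
  everywhere, also on the null set where a path may diverge.\<close>

definition "X_lim \<omega> = lim (\<lambda>k. X k \<omega>)"

lemma X_lim_measurable [measurable]: "X_lim \<in> borel_measurable P"
  unfolding X_lim_def[abs_def] by measurable

lemma AE_X_lim:
  "AE \<omega> in P. (\<lambda>k. X k \<omega>) \<longlonglongrightarrow> X_lim \<omega> \<and> f (X_lim \<omega>) = min_value f \<and>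
    eventually (\<lambda>k. norm (X k \<omega> - X_lim \<omega>) \<le> sqrt 2 / (c1 * sqrt \<nu>) * \<phi> (t k)) sequentially"
  using AE_regular AE_r_le_t_Suc
proof eventually_elim
  case (elim \<omega>)
  obtain L where L: "(\<lambda>k. X k \<omega>) \<longlonglongrightarrow> L" "f L = min_value f"
    "eventually (\<lambda>k. norm (X k \<omega> - L) \<le> sqrt 2 / (c1 * sqrt \<nu>) * \<phi> (t k)) sequentially"
    using convergent_path[OF elim] .
  moreover have "X_lim \<omega> = L" unfolding X_lim_def using L(1) by (rule limI)
  ultimately show ?case by simp
qed

lemma X_lim_bounded: "\<exists>R. (\<forall>k. \<forall>\<omega>\<in>space P. norm (X k \<omega>) \<le> R) \<and> (AE \<omega> in P. norm (X_lim \<omega>) \<le> R)"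
proof -
  obtain R where R: "\<And>k \<omega>. \<omega> \<in> space P \<Longrightarrow> norm (X k \<omega>) \<le> R" using X_bounded by blast
  have "AE \<omega> in P. norm (X_lim \<omega>) \<le> R"
    using AE_X_lim AE_space
  proof eventually_elim
    case (elim \<omega>)
    then show ?case using R by (intro Lim_norm_ubound[of sequentially "\<lambda>k. X k \<omega>"]) auto
  qed
  with R show ?thesis by blast
qed

text \<open>All iterates lie in the compact sublevel set of the start, so dominated convergence
  applies with a constant bound.\<close>

lemma converges_in_L1_X_lim: "converges_in_L1 P X X_lim"
proof -
  obtain R where R: "\<And>k \<omega>. \<omega> \<in> space P \<Longrightarrow> norm (X k \<omega>) \<le> R" "AE \<omega> in P. norm (X_lim \<omega>) \<le> R"
    using X_lim_bounded by blast
  have "(\<lambda>k. \<integral>\<omega>. norm (X k \<omega> - X_lim \<omega>) \<partial>P) \<longlonglongrightarrow> (\<integral>\<omega>. 0 \<partial>P)"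
  proof (rule integral_dominated_convergence[where w = "\<lambda>_. R + R"])
    show "AE \<omega> in P. (\<lambda>k. norm (X k \<omega> - X_lim \<omega>)) \<longlonglongrightarrow> 0"
      using AE_X_lim by eventually_elim (simp add: LIM_zero tendsto_norm_zero)
    show "AE \<omega> in P. norm (norm (X k \<omega> - X_lim \<omega>)) \<le> R + R" for k
      using R(2) AE_space
    proof eventually_elim
      case (elim \<omega>)
      then show ?case
        using R(1)[of \<omega> k] norm_triangle_ineq4[of "X k \<omega>" "X_lim \<omega>"] by simp
    qed
  qed measurable
  then show ?thesis
    using integrable_bounded[OF X_lim_measurable R(2)] by (simp add: converges_in_L1_def X_integrable)
qed

text \<open>The bound in \<open>expectation_X_diff_le\<close> does not depend on \<open>n\<close>;
  dominated convergence passes to the limit.\<close>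

lemma expectation_X_lim_diff_le:
  "(\<integral>\<omega>. norm (X k \<omega> - X_lim \<omega>) \<partial>P) \<le> M / (c1 * \<nu>) * \<phi> (\<integral>\<omega>. r k \<omega> \<partial>P)"
proof (rule tendsto_upperbound)
  obtain R where R: "\<And>k \<omega>. \<omega> \<in> space P \<Longrightarrow> norm (X k \<omega>) \<le> R" using X_bounded by blast
  show "(\<lambda>n. \<integral>\<omega>. norm (X n \<omega> - X k \<omega>) \<partial>P) \<longlonglongrightarrow> (\<integral>\<omega>. norm (X k \<omega> - X_lim \<omega>) \<partial>P)"
  proof (rule integral_dominated_convergence[where w = "\<lambda>_. R + R"])
    show "AE \<omega> in P. (\<lambda>n. norm (X n \<omega> - X k \<omega>)) \<longlonglongrightarrow> norm (X k \<omega> - X_lim \<omega>)"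
      using AE_X_lim
    proof eventually_elim
      case (elim \<omega>)
      then have "(\<lambda>n. norm (X n \<omega> - X k \<omega>)) \<longlonglongrightarrow> norm (X_lim \<omega> - X k \<omega>)" by (intro tendsto_intros) simp
      then show ?case by (simp add: norm_minus_commute)
    qed
    show "AE \<omega> in P. norm (norm (X n \<omega> - X k \<omega>)) \<le> R + R" for n
      using AE_space
    proof eventually_elim
      case (elim \<omega>)
      then show ?case
        using R[of \<omega> n] R[of \<omega> k] norm_triangle_ineq4[of "X n \<omega>" "X k \<omega>"] by simp
    qed
  qed measurable
  show "eventually (\<lambda>n. (\<integral>\<omega>. norm (X n \<omega> - X k \<omega>) \<partial>P) \<le> M / (c1 * \<nu>) * \<phi> (\<integral>\<omega>. r k \<omega> \<partial>P)) sequentially"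
    using expectation_X_diff_le by (rule eventually_sequentiallyI)
qed simp

lemma X_lim_argmin: "AE \<omega> in P. X_lim \<omega> \<in> argmin_on {y. f y \<le> f x0} f"
  using AE_X_lim by eventually_elim (simp add: mem_argmin_on_iff min_value_le)

end


section \<open>Rates of convergence\<close>

theorem theorem9:
  fixes P :: "'a measure" and F :: "nat \<Rightarrow> 'a measure"
    and D :: "nat \<Rightarrow> real list set set"
    and f :: "real^'d::finite \<Rightarrow> real" and x0 :: "real^'d"
    and \<alpha> :: "nat \<Rightarrow> real" and \<alpha>_bar :: real
    and B :: "nat \<Rightarrow> 'a \<Rightarrow> real^'d^'d"
    and M \<nu> t0 :: real and \<phi> :: "real \<Rightarrow> real"
  defines "x \<equiv> grsd f \<alpha> B x0"
    and "f_min \<equiv> min_value f"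
    and "S \<equiv> {y. f y \<le> f x0}"
    and "\<Phi> \<equiv> (\<lambda>t. if t = 0 then 0 else 1 / (deriv \<phi> t)\<^sup>2)"
    and "\<psi> \<equiv> KL_psi \<phi> t0"
    and "\<psi>_inv \<equiv> KL_psi_inv \<phi> t0"
    and "c1 \<equiv> (1 - \<alpha>_bar / 2) / M"
    and "c2 \<equiv> \<nu>"
    and "c3 \<equiv> M\<^sup>2"
    and "h \<equiv> (1 - ln 2) / 2"
    and "A \<equiv> (\<lambda>k. \<Sum>i<k. \<alpha> i)"
  assumes prob: "prob_space P"
    and filt: "filtration (space P) F" "\<And>k. subalgebra P (F k)"
    and B_meas: "\<And>k. B k \<in> borel_measurable (F (Suc k))"
    and B_psd: "\<And>k \<omega>. \<omega> \<in> space P \<Longrightarrow> psd (B k \<omega>)"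
    and o_min: "o_minimal_structure D"
    and f_C1: "C1_fun f" and f_coercive: "coercive f" and f_convex: "convex_on UNIV f"
    and f_definable: "definable_fun D f" and f_grad_lipschitz: "locally_lipschitz (grad f)"
    and step: "\<And>k. 0 < \<alpha> k" "\<And>k. \<alpha> k \<le> \<alpha>_bar" "\<alpha>_bar < 2"
    and step_sum: "filterlim (\<lambda>n. \<Sum>k<n. \<alpha> k) at_top sequentially"
    and smooth: "\<And>B'. B' \<in> realizations P B \<Longrightarrow> upper_1_smooth_along f B'"
    and M_pos: "M > 0" and \<nu>_pos: "\<nu> > 0"
    and B_bound: "\<And>k. AE \<omega> in P. loewner_le 0 (B k \<omega>) \<and> loewner_le (B k \<omega>) (M *\<^sub>R mat 1)"
    and B_cond: "\<And>k. AE \<omega> in P.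
        loewner_le (\<nu> *\<^sub>R mat 1) (cond_exp_matrix P (F k) (\<lambda>\<omega>'. B k \<omega>' ** B k \<omega>') \<omega>)"
    and KL: "KL_desingularization f \<phi>"
    and t0_pos: "t0 > 0"
  shows "(integrable_near_0 (\<lambda>t. 1 / sqrt (\<Phi> t))) \<and>
    (\<not> integrable_near_0 (\<lambda>t. 1 / \<Phi> t)) \<and>
    (\<forall>k. integrable P (\<lambda>\<omega>. f (x k \<omega>) - f_min)) \<and>
    (\<forall>k\<ge>1. (\<integral>\<omega>. f (x k \<omega>) - f_min \<partial>P)
           \<le> exp (- h * (c2 / (c3 * \<alpha>_bar)) * A k) * (f x0 - f_min)
             + \<psi>_inv (\<psi> (f x0 - f_min) + ereal (c1 * c2 / 2 * A k))) \<and>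
    (\<exists>x_lim.
           x_lim \<in> borel_measurable P \<and>
           (AE \<omega> in P. (\<lambda>k. x k \<omega>) \<longlonglongrightarrow> x_lim \<omega>) \<and>
           converges_in_L1 P x x_lim \<and>
           (AE \<omega> in P. x_lim \<omega> \<in> argmin_on S f) \<and>
           (\<forall>k. (\<integral>\<omega>. norm (x k \<omega> - x_lim \<omega>) \<partial>P)
                  \<le> sqrt c3 / (c1 * c2) * \<phi> (\<integral>\<omega>. f (x k \<omega>) - f_min \<partial>P)) \<and>
           (\<exists>K2 K3 :: 'a \<Rightarrow> enat.
              K2 \<in> measurable P (count_space UNIV) \<and> (AE \<omega> in P. K2 \<omega> < \<infinity>) \<and>
              K3 \<in> measurable P (count_space UNIV) \<and> (AE \<omega> in P. K3 \<omega> < \<infinity>) \<and>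
              (AE \<omega> in P. \<forall>k. K2 \<omega> \<le> enat k \<longrightarrow>
                 f (x k \<omega>) - f_min \<le> \<psi>_inv (ereal (c1 * c2 / 2 * A k))) \<and>
              (AE \<omega> in P. \<forall>k. K3 \<omega> \<le> enat k \<longrightarrow>
                 norm (x k \<omega> - x_lim \<omega>)
                   \<le> sqrt 2 / (c1 * sqrt c2) * \<phi> (\<psi>_inv (ereal (c1 * c2 / 2 * A k))))))"
proof -
  have cont: "continuous_on UNIV f" using f_C1 by (rule C1_fun_continuous_on)
  obtain z where z: "\<And>y. f z \<le> f y" using coercive_attains_minimum[OF f_coercive cont] by blast
  have min: "min_value f \<le> f y" "min_value f \<in> range f" for y
    using min_value_eq[of f z, OF z] z by auto
  interpret prob_space P by (rule prob)
  interpret filtration "space P" F by (rule filt(1))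
  interpret KL: KL_function \<phi> t0
    using KL f_convex f_C1 f_coercive f_grad_lipschitz t0_pos min
    by (rule KL_function_if_KL_desingularization)
  interpret G: grsd_process P \<phi> t0 F f x0 \<alpha> \<alpha>_bar B M \<nu>
  proof
    show "AE \<omega> in P. loewner_le (B k \<omega>) (M *\<^sub>R mat 1)" for k
      using B_bound[of k] by eventually_elim simp
    show "1 \<le> deriv \<phi> (f y - min_value f) * norm (grad f y)" if "min_value f < f y" for y
      using KL_desingularization_gradient[OF KL that min] .
    show "upper_1_smooth_along f (B k \<omega>)" if "\<omega> \<in> space P" for k \<omega>
      using that by (intro smooth) (auto simp: realizations_def)
  qed (fact filt(2) B_meas B_psd B_cond f_C1 f_coercive step step_sum M_pos \<nu>_pos)+
  have c1: "c1 = G.c1" by (simp add: c1_def G.c1_def)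
  have A: "A = G.A" by (simp add: A_def G.A_def fun_eq_iff)
  have x: "x = G.X" by (simp add: x_def G.X_def fun_eq_iff)
  have r: "f (x k \<omega>) - f_min = G.r k \<omega>" for k \<omega> by (simp add: x G.r_def f_min_def)
  have t: "\<psi>_inv (ereal (c1 * c2 / 2 * A k)) = G.t k" for k
    by (simp add: \<psi>_inv_def c1 c2_def A G.t_def)
  have sqrt_c3: "sqrt c3 = M" using M_pos by (simp add: c3_def)
  \<comment> \<open>For positive arguments the reciprocals of \<open>sqrt (\<Phi> t)\<close> and
    \<open>\<Phi> t\<close> are \<open>deriv \<phi> t\<close> and its square. The value of
    \<open>\<Phi>\<close> at zero lies outside the half-open intervals of integration.\<close>
  have "integrable_near_0 (\<lambda>t. 1 / sqrt (\<Phi> t)) \<longleftrightarrow> integrable_near_0 (deriv \<phi>)"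
    by (rule integrable_near_0_cong) (simp add: \<Phi>_def real_sqrt_divide KL.deriv_pos less_imp_le)
  then have int1: "integrable_near_0 (\<lambda>t. 1 / sqrt (\<Phi> t))" using KL.integrable_near_0_deriv by simp
  have "integrable_near_0 (\<lambda>t. 1 / \<Phi> t) \<longleftrightarrow> integrable_near_0 (\<lambda>t. (deriv \<phi> t)\<^sup>2)"
    by (rule integrable_near_0_cong) (simp add: \<Phi>_def)
  then have int2: "\<not> integrable_near_0 (\<lambda>t. 1 / \<Phi> t)"
    using KL.not_integrable_near_0_deriv_square by simp
  have rate: "(\<integral>\<omega>. G.r k \<omega> \<partial>P) \<le> exp (- h * (c2 / (c3 * \<alpha>_bar)) * A k) * (f x0 - f_min)
             + \<psi>_inv (\<psi> (f x0 - f_min) + ereal (c1 * c2 / 2 * A k))" for k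
    unfolding h_def c1 c2_def c3_def A f_min_def \<psi>_def \<psi>_inv_def by (rule G.expectation_r_le)
  have L1: "(\<integral>\<omega>. norm (x k \<omega> - G.X_lim \<omega>) \<partial>P) \<le> sqrt c3 / (c1 * c2) * \<phi> (\<integral>\<omega>. G.r k \<omega> \<partial>P)" for k
    unfolding x sqrt_c3 c1 c2_def by (rule G.expectation_X_lim_diff_le)
  have K2: "\<exists>K2 :: 'a \<Rightarrow> enat. K2 \<in> measurable P (count_space UNIV) \<and> (AE \<omega> in P. K2 \<omega> < \<infinity>) \<and>
      (AE \<omega> in P. \<forall>k. K2 \<omega> \<le> enat k \<longrightarrow> G.r k \<omega> \<le> G.t k)"
    by (intro exists_measurable_threshold G.AE_r_le_t) measurable
  have AE_X: "AE \<omega> in P. eventually (\<lambda>k. norm (x k \<omega> - G.X_lim \<omega>)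
      \<le> sqrt 2 / (c1 * sqrt c2) * \<phi> (G.t k)) sequentially"
    using G.AE_X_lim unfolding x c1 c2_def by eventually_elim blast
  have K3: "\<exists>K3 :: 'a \<Rightarrow> enat. K3 \<in> measurable P (count_space UNIV) \<and> (AE \<omega> in P. K3 \<omega> < \<infinity>) \<and>
      (AE \<omega> in P. \<forall>k. K3 \<omega> \<le> enat k \<longrightarrow>
        norm (x k \<omega> - G.X_lim \<omega>) \<le> sqrt 2 / (c1 * sqrt c2) * \<phi> (G.t k))"
    using AE_X unfolding x by (intro exists_measurable_threshold) measurable
  have lim: "AE \<omega> in P. (\<lambda>k. x k \<omega>) \<longlonglongrightarrow> G.X_lim \<omega>"
    using G.AE_X_lim unfolding x by eventually_elim blast
  have L1_conv: "converges_in_L1 P x G.X_lim" unfolding x by (rule G.converges_in_L1_X_lim)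
  have argmin: "AE \<omega> in P. G.X_lim \<omega> \<in> argmin_on S f" unfolding S_def by (rule G.X_lim_argmin)
  obtain K2 K3 :: "'a \<Rightarrow> enat" where K:
    "K2 \<in> measurable P (count_space UNIV)" "AE \<omega> in P. K2 \<omega> < \<infinity>"
    "K3 \<in> measurable P (count_space UNIV)" "AE \<omega> in P. K3 \<omega> < \<infinity>"
    "AE \<omega> in P. \<forall>k. K2 \<omega> \<le> enat k \<longrightarrow> G.r k \<omega> \<le> G.t k"
    "AE \<omega> in P. \<forall>k. K3 \<omega> \<le> enat k \<longrightarrow>
      norm (x k \<omega> - G.X_lim \<omega>) \<le> sqrt 2 / (c1 * sqrt c2) * \<phi> (G.t k)"
    using K2 K3 by blast
  show ?thesis
    unfolding r t
    by (intro conjI allI impI exI[of _ G.X_lim] exI[of _ K2] exI[of _ K3] int1 int2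
        G.r_integrable rate G.X_lim_measurable lim L1_conv argmin L1 K)
qed

end
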